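(* (i) For every nonnegative integer $k$ and every graph $G$, if $G$ is reduced for $(2,k)$-LCP and has at least $8k$ edges, then $G\in(2,k)$-LCP. (ii) Consequently, the problem $(2,k)$-Load Coloring, parameterized by $k$ (with $k\ge 1$), admits a kernel with less than $8k$ edges.
   Context: Graphs are finite, simple and undirected; $N(v)$ is the set of neighbors of $v$; $[c]=\{1,\dots,c\}$. $(c,k)$-Load Coloring: given a graph $G=(V,E)$, a positive integer $c$ and a nonnegative integer $k$, decide whether there is a map $\varphi:V\to[c]$ such that for every $i\in[c]$ at least $k$ edges have both endvertices colored $i$. Write $G\in(c,k)$-LCP if such a $\varphi$ exists. Obstacle: for integers $i,k\ge 0$, a pair $(V_1,V_2)$ of disjoint vertex sets of $G$ with $V_1\cup V_2\neq\emptyset$ is an obstacle from $O_{i,k}$ if $|V_1|=i$, $N(v)\subseteq V_1$ for all $v\in V_2$, and for every $u\in V_1$ there is a set $V_u\subseteq N(u)\cap V_2$ with $|V_u|\ge k$ such that $V_u\cap V_v=\emptyset$ for all distinct $u,v\in V_1$. (For example, if $v$ is an isolated vertex, then $(\emptyset,\{v\})$ is an obstacle from $O_{0,k}$.) Reduction rule $R_{i,k}$: if an instance $G$ of $(c,k)$-LCP contains an obstacle $(V_1,V_2)$ from $O_{i,k}$, delete all vertices of $V_1\cup V_2$ and decrease $c$ by $i$. A graph $G$ is reduced for $(c,k)$-LCP if no rule $R_{i,k}$ with $0\le i<c$ can be applied, i.e. $G$ contains no obstacle from $O_{i,k}$ for any $0\le i<c$. Kernel: $(2,k)$-Load Coloring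 admits a kernel with less than $s(k)$ edges if there is a polynomial-time algorithm mapping each instance $(G,k)$ to an instance $(G',k')$ of the same problem such that $G\in(2,k)$-LCP if and only if $G'\in(2,k')$-LCP, $k'\le g(k)$ and the size of $G'$ is at most $g(k)$ for some function $g$ of $k$ only, and $|E(G')|<s(k)$. *)

theory Defs
  imports "HOL-Library.Log_Nat" "HOL-Computational_Algebra.Polynomial"
begin

section \<open>Graphs, load colorings and obstacles\<close>

type_synonym 'a ugraph = "'a set \<times> 'a set set"

abbreviation verts :: "'a ugraph \<Rightarrow> 'a set" where "verts \<equiv> fst"
abbreviation edges :: "'a ugraph \<Rightarrow> 'a set set" where "edges \<equiv> snd"

definition simple_graph :: "'a ugraph \<Rightarrow> bool" where
  "simple_graph G \<longleftrightarrow> finite (verts G) \<and> edges G \<subseteq> {e. e \<subseteq> verts G \<and> card e = 2}"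

definition neighbors :: "'a ugraph \<Rightarrow> 'a \<Rightarrow> 'a set" where
  "neighbors G v = {u \<in> verts G. {u, v} \<in> edges G}"

definition LCP :: "nat \<Rightarrow> nat \<Rightarrow> 'a ugraph set" where
  "LCP c k = {G. \<exists>\<phi> :: 'a \<Rightarrow> nat. \<phi> ` verts G \<subseteq> {1..c} \<and>
     (\<forall>i\<in>{1..c}. card {e \<in> edges G. \<forall>v\<in>e. \<phi> v = i} \<ge> k)}"

definition obstacle :: "nat \<Rightarrow> nat \<Rightarrow> 'a ugraph \<Rightarrow> 'a set \<Rightarrow> 'a set \<Rightarrow> bool" where
  "obstacle i k G V1 V2 \<longleftrightarrow>
     V1 \<subseteq> verts G \<and> V2 \<subseteq> verts G \<and> V1 \<inter> V2 = {} \<and> V1 \<union> V2 \<noteq> {} \<and> card V1 = i \<and>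
     (\<forall>v\<in>V2. neighbors G v \<subseteq> V1) \<and>
     (\<exists>W :: 'a \<Rightarrow> 'a set.
        (\<forall>u\<in>V1. W u \<subseteq> neighbors G u \<inter> V2 \<and> card (W u) \<ge> k) \<and>
        (\<forall>u\<in>V1. \<forall>v\<in>V1. u \<noteq> v \<longrightarrow> W u \<inter> W v = {}))"

definition reduced :: "nat \<Rightarrow> nat \<Rightarrow> 'a ugraph \<Rightarrow> bool" where
  "reduced c k G \<longleftrightarrow> (\<forall>i<c. \<not> (\<exists>V1 V2. obstacle i k G V1 V2))"


section \<open>Polynomial time\<close>

text \<open>
  The machine model is the random access machine with unit cost, here with structured control
  flow. The state consists of the contents of the registers and of the memory cells, each of
  which holds a natural number. A program mentions only finitely many registers; the memory is
  addressed indirectly. Arithmetic is restricted to addition and truncated subtraction, so a run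
  of \<open>t\<close> steps on an input of bit size \<open>m\<close> only involves numbers with \<open>O(m + t)\<close> bits. Hence
  polynomial time for this model is the same as polynomial time for Turing machines (this would
  fail if multiplication were available at unit cost).
\<close>

type_synonym state = "(nat \<Rightarrow> nat) \<times> (nat \<Rightarrow> nat)"

datatype com =
    Const nat nat           \<comment> \<open>\<open>R[r] := n\<close>\<close>
  | Add nat nat nat         \<comment> \<open>\<open>R[r] := R[a] + R[b]\<close>\<close>
  | Sub nat nat nat         \<comment> \<open>\<open>R[r] := R[a] - R[b]\<close>, truncated at 0\<close>
  | Load nat nat            \<comment> \<open>\<open>R[r] := M[R[a]]\<close>\<close>
  | Store nat nat           \<comment> \<open>\<open>M[R[a]] := R[b]\<close>\<close>
  | Seq com com
  | IfLess nat nat com com  \<comment> \<open>if \<open>R[a] < R[b]\<close> then \<dots> else \<dots>\<close>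
  | WhileLess nat nat com   \<comment> \<open>while \<open>R[a] < R[b]\<close> do \<dots>\<close>

text \<open>\<open>exec c s t s'\<close>: started in \<open>s\<close>, the program \<open>c\<close> halts after \<open>t\<close> steps in \<open>s'\<close>.\<close>

inductive exec :: "com \<Rightarrow> state \<Rightarrow> nat \<Rightarrow> state \<Rightarrow> bool" where
  Const: "exec (Const r n) (R, M) 1 (R(r := n), M)"
| Add: "exec (Add r a b) (R, M) 1 (R(r := R a + R b), M)"
| Sub: "exec (Sub r a b) (R, M) 1 (R(r := R a - R b), M)"
| Load: "exec (Load r a) (R, M) 1 (R(r := M (R a)), M)"
| Store: "exec (Store a b) (R, M) 1 (R, M(R a := R b))"
| Seq: "exec c s t s' \<Longrightarrow> exec d s' u s'' \<Longrightarrow> exec (Seq c d) s (t + u) s''"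
| IfTrue: "fst s a < fst s b \<Longrightarrow> exec c s t s' \<Longrightarrow> exec (IfLess a b c d) s (Suc t) s'"
| IfFalse: "\<not> fst s a < fst s b \<Longrightarrow> exec d s t s' \<Longrightarrow> exec (IfLess a b c d) s (Suc t) s'"
| WhileTrue: "fst s a < fst s b \<Longrightarrow> exec c s t s' \<Longrightarrow> exec (WhileLess a b c) s' u s'' \<Longrightarrow>
    exec (WhileLess a b c) s (Suc (t + u)) s''"
| WhileFalse: "\<not> fst s a < fst s b \<Longrightarrow> exec (WhileLess a b c) s 1 s"

lemma exec_deterministic:
  "exec c s t s' \<Longrightarrow> exec c s u s'' \<Longrightarrow> u = t \<and> s'' = s'"
proof (induction arbitrary: u s'' rule: exec.induct)
  case Seq
  from Seq.prems show ?case by cases (use Seq.IH in blast)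
next
  case IfTrue
  from IfTrue.prems show ?case by cases (use IfTrue in blast)+
next
  case IfFalse
  from IfFalse.prems show ?case by cases (use IfFalse in blast)+
next
  case WhileTrue
  from WhileTrue.prems show ?case by cases (use WhileTrue in blast)+
next
  case WhileFalse
  from WhileFalse.prems show ?case by cases (use WhileFalse in blast)+
qed (auto elim: exec.cases)

definition initial_state :: "nat list \<Rightarrow> state" where
  "initial_state xs = (\<lambda>_. 0, \<lambda>i. if i < length xs then xs ! i else 0)"

text \<open>
  The number of binary digits of all entries, plus one separator per entry (\<open>floorlog 2 x\<close> is the
  number of binary digits of \<open>x\<close>, with value \<open>0\<close> for \<open>x = 0\<close>).
\<close>

definition bit_size :: "nat list \<Rightarrow> nat" where
  "bit_size xs = (\<Sum>x\<leftarrow>xs. Suc (floorlog 2 x))"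

text \<open>
  The output is read off the first memory cells; the remaining ones are scratch space. So \<open>enc\<close>
  is meant to be self-delimiting, as is the encoding of instances below.
\<close>

definition poly_time_computable :: "('i \<Rightarrow> nat list) \<Rightarrow> 'i set \<Rightarrow> ('i \<Rightarrow> 'i) \<Rightarrow> bool" where
  "poly_time_computable enc A f \<longleftrightarrow>
     (\<exists>(prog :: com) (p :: nat poly). \<forall>x\<in>A. \<exists>t s'.
        exec prog (initial_state (enc x)) t s' \<and>
        t \<le> poly p (bit_size (enc x)) \<and>
        (\<forall>i<length (enc (f x)). snd s' i = enc (f x) ! i))"


section \<open>Kernels for load coloring\<close>

text \<open>As input to an algorithm, a graph with \<open>n\<close> vertices has the vertex set \<open>{0,\<dots>,n-1}\<close>.\<close>

definition instances :: "(nat ugraph \<times> nat) set" where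
  "instances = {(G, k). simple_graph G \<and> verts G = {..<card (verts G)} \<and> k \<ge> 1}"

text \<open>The number of vertices, the parameter, and the rows of the adjacency matrix.\<close>

definition encode :: "nat ugraph \<times> nat \<Rightarrow> nat list" where
  "encode = (\<lambda>(G, k). let n = card (verts G) in
     n # k # concat (map (\<lambda>u. map (\<lambda>v. of_bool ({u, v} \<in> edges G)) [0..<n]) [0..<n]))"

definition has_load_coloring_kernel :: "nat \<Rightarrow> (nat \<Rightarrow> nat) \<Rightarrow> bool" where
  "has_load_coloring_kernel c s \<longleftrightarrow>
     (\<exists>(f :: nat ugraph \<times> nat \<Rightarrow> nat ugraph \<times> nat) (g :: nat \<Rightarrow> nat).
        poly_time_computable encode instances f \<and>
        (\<forall>(G, k)\<in>instances. \<exists>G' k'. f (G, k) = (G', k') \<and> (G', k') \<in> instances \<and>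
           (G \<in> LCP c k \<longleftrightarrow> G' \<in> LCP c k') \<and>
           k' \<le> g k \<and> card (verts G') + card (edges G') \<le> g k \<and>
           card (edges G') < s k))"

end

(*
  (i) Only a vertex u with at least k leaves attached has to be excluded. If some vertex u has
  degree at least 3k, color 2 can collect k edges greedily on at most 2k vertices, because more
  than 2k neighbors of u have another neighbor; u keeps k neighbors. If the degree d of u is
  between 2k + 2 and 3k, give u the k neighbors whose successive removal destroys the fewest other
  edges; the fraction of the at least 5k + 1 edges avoiding u that survives is at least
  (d-k)(d-k-1) / (d(d-1)) >= 1/4. If all degrees are at most 2k + 1, write a coloring as signs
  s(v) = 1, -1; with m edges, the color class t has (m + t sum_v d(v) s(v) + sum_{uv in E} s(u) s(v)) / 4.
  Signs with |sum d s| <= 2k + 1 and the last sum at least -p exist, where p is the size of some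
  matching. If p >= 2k, split the matching; otherwise each class has at least
  (8k - (2k+1) - (2k-1)) / 4 = k edges.

  (ii) If u has at least k leaves, G is a yes-instance iff at least k edges avoid u; by (i) it is a
  yes-instance if no such u exists and there are at least 8k edges. In the remaining case removing
  the isolated vertices suffices. All this needs only the vertex degrees and a few scans of the
  adjacency matrix, and the new matrix can overwrite the old one.
*)

theory Submission
  imports Defs
begin

section \<open>Edge counts as sums over the adjacency matrix\<close>

section \<open>Counting edges\<close>

definition edges_in :: "'a ugraph \<Rightarrow> 'a set \<Rightarrow> 'a set set" where
  "edges_in G A = {e \<in> edges G. e \<subseteq> A}"

text \<open>Integer-valued so that it can be multiplied by signs and subtracted without
  truncation.\<close>

definition adj :: "'a ugraph \<Rightarrow> 'a \<Rightarrow> 'a \<Rightarrow> int" where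
  "adj G u v = of_bool ({u, v} \<in> edges G)"

text \<open>The leaves attached to \<open>u\<close>.\<close>

definition pendants :: "'a ugraph \<Rightarrow> 'a \<Rightarrow> 'a set" where
  "pendants G u = {v \<in> neighbors G u. neighbors G v = {u}}"

lemma simple_graphD:
  assumes "simple_graph G"
  shows "finite (verts G)" and "finite (edges G)"
    and "\<And>e. e \<in> edges G \<Longrightarrow> e \<subseteq> verts G" and "\<And>e. e \<in> edges G \<Longrightarrow> card e = 2"
  using assms finite_subset[of "edges G" "Pow (verts G)"] by (auto simp: simple_graph_def)

lemma finite_edges_in: "simple_graph G \<Longrightarrow> finite (edges_in G A)"
  by (simp add: edges_in_def simple_graphD)

lemma edges_in_mono: "A \<subseteq> B \<Longrightarrow> edges_in G A \<subseteq> edges_in G B"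
  by (auto simp: edges_in_def)

lemma edges_in_verts: "simple_graph G \<Longrightarrow> edges_in G (verts G) = edges G"
  by (auto simp: edges_in_def dest: simple_graphD)

lemma adj_commute: "adj G u v = adj G v u"
  by (simp add: adj_def insert_commute)

lemma adj_irrefl: "simple_graph G \<Longrightarrow> adj G u u = 0"
  using simple_graphD(4)[of G "{u}"] by (auto simp: adj_def)

lemma not_loop: "simple_graph G \<Longrightarrow> {u} \<notin> edges G"
  using simple_graphD(4)[of G "{u}"] by auto

lemma finite_neighbors: "simple_graph G \<Longrightarrow> finite (neighbors G u)"
  by (simp add: neighbors_def simple_graphD)

lemma neighbors_iff: "simple_graph G \<Longrightarrow> v \<in> neighbors G u \<longleftrightarrow> {u, v} \<in> edges G"
  using simple_graphD(3)[of G "{u, v}"] by (auto simp: neighbors_def insert_commute)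

text \<open>Enlarging a color class never loses edges inside it, so the two sets need not cover the
  vertices: everything outside \<open>A\<close> can get color 2.\<close>

lemma LCP_2_iff:
  assumes "simple_graph G"
  shows "G \<in> LCP 2 k \<longleftrightarrow>
    (\<exists>A B. A \<inter> B = {} \<and> k \<le> card (edges_in G A) \<and> k \<le> card (edges_in G B))"
proof
  assume "G \<in> LCP 2 k"
  then obtain \<phi> :: "'a \<Rightarrow> nat"
    where \<phi>: "\<And>i. i \<in> {1..2} \<Longrightarrow> k \<le> card {e \<in> edges G. \<forall>v\<in>e. \<phi> v = i}"
    unfolding LCP_def by blast
  let ?C = "\<lambda>i. {v. \<phi> v = i}"
  have "edges_in G (?C i) = {e \<in> edges G. \<forall>v\<in>e. \<phi> v = i}" for i
    by (auto simp: edges_in_def)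
  then show "\<exists>A B. A \<inter> B = {} \<and> k \<le> card (edges_in G A) \<and> k \<le> card (edges_in G B)"
    using \<phi>[of 1] \<phi>[of 2] by (intro exI[of _ "?C 1"] exI[of _ "?C 2"]) auto
next
  assume "\<exists>A B. A \<inter> B = {} \<and> k \<le> card (edges_in G A) \<and> k \<le> card (edges_in G B)"
  then obtain A B where AB: "A \<inter> B = {}" "k \<le> card (edges_in G A)" "k \<le> card (edges_in G B)"
    by blast
  let ?\<phi> = "\<lambda>v. if v \<in> A then 1 else 2 :: nat"
  have "card (edges_in G A) \<le> card {e \<in> edges G. \<forall>v\<in>e. ?\<phi> v = 1}"
    "card (edges_in G B) \<le> card {e \<in> edges G. \<forall>v\<in>e. ?\<phi> v = 2}"
    using AB(1) by (auto intro!: card_mono simp: simple_graphD[OF assms] edges_in_def)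
  moreover have "{1..2} = {1, 2 :: nat}" by auto
  ultimately show "G \<in> LCP 2 k"
    using AB unfolding LCP_def by (intro CollectI exI[of _ ?\<phi>]) auto
qed

text \<open>Every edge inside \<open>A\<close> arises from exactly two ordered pairs, so the double
  sums below count each edge twice.\<close>

lemma sum_adj_eq_card_edges_in:
  assumes "simple_graph G" "finite A"
  shows "(\<Sum>u\<in>A. \<Sum>v\<in>A. adj G u v) = 2 * int (card (edges_in G A))"
proof -
  let ?P = "\<lambda>e. {(u, v). {u, v} = e}"
  have P: "finite (?P e)" "card (?P e) = 2" if e: "e \<in> edges_in G A" for e
  proof -
    obtain a b where "e = {a, b}" "a \<noteq> b"
      using simple_graphD(4)[OF assms(1), of e] e unfolding edges_in_def card_2_iff by blast
    then have "?P e = {(a, b), (b, a)}"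
      by (auto simp: doubleton_eq_iff)
    then show "finite (?P e)" "card (?P e) = 2" using \<open>a \<noteq> b\<close> by auto
  qed
  have "(\<Sum>u\<in>A. \<Sum>v\<in>A. adj G u v) = (\<Sum>(u, v)\<in>A \<times> A. adj G u v)"
    by (simp add: sum.cartesian_product)
  also have "\<dots> = int (card ((A \<times> A) \<inter> {x. {fst x, snd x} \<in> edges G}))"
    using assms(2) by (simp add: adj_def split_beta)
  also have "(A \<times> A) \<inter> {x. {fst x, snd x} \<in> edges G} = (\<Union>e\<in>edges_in G A. ?P e)"
    by (auto simp: edges_in_def)
  also have "card \<dots> = (\<Sum>e\<in>edges_in G A. card (?P e))"
    using P by (intro card_UN_disjoint) (auto simp: finite_edges_in assms)
  finally show ?thesis using P by simp
qed

lemma sum_adj_eq_degree: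
  assumes "simple_graph G"
  shows "(\<Sum>v\<in>verts G. adj G u v) = int (card (neighbors G u))"
proof -
  have "neighbors G u = verts G \<inter> {v. {u, v} \<in> edges G}"
    by (auto simp: neighbors_def insert_commute)
  then show ?thesis by (simp add: adj_def simple_graphD assms)
qed

lemma handshake:
  assumes "simple_graph G"
  shows "(\<Sum>u\<in>verts G. card (neighbors G u)) = 2 * card (edges G)"
proof -
  have "int (\<Sum>u\<in>verts G. card (neighbors G u)) = int (2 * card (edges G))"
    using sum_adj_eq_card_edges_in[OF assms simple_graphD(1)[OF assms]]
    by (simp add: edges_in_verts assms sum_adj_eq_degree)
  then show ?thesis by linarith
qed

lemma star_card_edges_in:
  assumes "simple_graph G" "S \<subseteq> neighbors G u" "insert u S \<subseteq> A"
  shows "card S \<le> card (edges_in G A)"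
proof -
  have "inj_on (\<lambda>v. {u, v}) S" by (auto simp: inj_on_def doubleton_eq_iff)
  then have "card S = card ((\<lambda>v. {u, v}) ` S)" by (simp add: card_image)
  also have "\<dots> \<le> card (edges_in G A)"
    using assms by (intro card_mono finite_edges_in)
      (auto simp: edges_in_def neighbors_def insert_commute)
  finally show ?thesis .
qed

text \<open>The row and the column of \<open>x\<close> agree by symmetry, and their common diagonal
  entry is 0.\<close>

lemma sum_adj_remove:
  assumes "simple_graph G" "finite X" "x \<in> X"
  shows "(\<Sum>u\<in>X. \<Sum>v\<in>X. adj G u v) =
    (\<Sum>u\<in>X - {x}. \<Sum>v\<in>X - {x}. adj G u v) + 2 * (\<Sum>v\<in>X. adj G x v)"
proof -
  have "(\<Sum>u\<in>X. \<Sum>v\<in>X. adj G u v) =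
      (\<Sum>v\<in>X. adj G x v) + (\<Sum>u\<in>X - {x}. adj G u x + (\<Sum>v\<in>X - {x}. adj G u v))"
    using assms(2,3) by (simp add: sum.remove[of X x])
  moreover have "(\<Sum>v\<in>X. adj G x v) = (\<Sum>u\<in>X - {x}. adj G u x)"
    using assms by (simp add: sum.remove[of X x "adj G x"] adj_irrefl)
      (intro sum.cong refl adj_commute)
  ultimately show ?thesis by (simp add: sum.distrib)
qed

lemma card_edges_remove:
  assumes "simple_graph G" "u \<in> verts G"
  shows "card (edges G) = card (edges_in G (verts G - {u})) + card (neighbors G u)"
proof -
  have "finite (verts G)" using assms(1) by (rule simple_graphD)
  then have "2 * int (card (edges G)) = 2 * int (card (edges_in G (verts G - {u})))
      + 2 * int (card (neighbors G u))"
    using sum_adj_remove[OF assms(1) _ assms(2)] sum_adj_eq_card_edges_in[OF assms(1)]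
      sum_adj_eq_degree[OF assms(1), of u] edges_in_verts[OF assms(1)]
    by (metis finite_Diff)
  then show ?thesis by linarith
qed

section \<open>Degree conditions that force two disjoint vertex sets with \<open>k\<close> edges
  each\<close>

section \<open>Dense partitions\<close>

text \<open>Greedy removal from \<open>N\<close>, each time of a vertex with the fewest remaining
  edges. With \<open>q\<close> candidates left this keeps at least the fraction
  \<open>(q - 2) / q\<close> of the edges, and the product over \<open>q = d, ..., d - j + 1\<close>
  telescopes. Denominators are cleared; \<open>e2\<close> is twice the edge count.\<close>

lemma exists_sparse_removal:
  assumes G: "simple_graph G" and X: "finite X" "N \<subseteq> X" and "j \<le> card N"
  defines "e2 \<equiv> \<lambda>X. \<Sum>u\<in>X. \<Sum>v\<in>X. adj G u v" and "d \<equiv> int (card N)"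
  shows "\<exists>S\<subseteq>N. card S = j \<and> e2 X * ((d - int j) * (d - int j - 1)) \<le> e2 (X - S) * (d * (d - 1))"
  using \<open>j \<le> card N\<close>
proof (induction j)
  case 0
  then show ?case by (intro exI[of _ "{}"]) simp
next
  case (Suc j)
  then obtain S where S: "S \<subseteq> N" "card S = j"
    "e2 X * ((d - int j) * (d - int j - 1)) \<le> e2 (X - S) * (d * (d - 1))"
    by auto
  define q where "q = d - int j"
  have finN: "finite N" using X by (rule finite_subset[rotated])
  note fin = finN finite_subset[OF S(1) finN]
  have q: "int (card (N - S)) = q" "q \<ge> 1"
    using S(1,2) Suc.prems fin by (auto simp: card_Diff_subset q_def d_def of_nat_diff)
  define deg where "deg = (\<lambda>x. \<Sum>v\<in>X - S. adj G x v)"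
  have deg_nonneg: "deg x \<ge> 0" for x by (simp add: deg_def adj_def sum_nonneg)
  have ne: "N - S \<noteq> {}" using q by (metis card.empty int_ops(1) not_one_le_zero)
  have "\<exists>x\<in>N - S. \<forall>y\<in>N - S. deg x \<le> deg y"
    using ex_is_arg_min_if_finite[of "N - S" deg] ne fin
    by (auto simp: is_arg_min_linorder)
  then obtain x where x: "x \<in> N - S" "\<And>y. y \<in> N - S \<Longrightarrow> deg x \<le> deg y" by blast
  \<comment> \<open>The minimum degree over \<open>N - S\<close> is at most the average there, and
    the degree sum only grows when extended to \<open>X - S\<close>.\<close>
  have "q * deg x = (\<Sum>y\<in>N - S. deg x)" by (simp add: q)
  also have "\<dots> \<le> (\<Sum>y\<in>N - S. deg y)" by (intro sum_mono x)
  also have "\<dots> \<le> (\<Sum>y\<in>X - S. deg y)"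
    using X by (intro sum_mono2) (auto simp: deg_nonneg)
  also have "\<dots> = e2 (X - S)" by (simp add: e2_def deg_def)
  finally have qd: "q * deg x \<le> e2 (X - S)" .
  have "e2 (X - S) = e2 (X - S - {x}) + 2 * deg x"
    unfolding e2_def deg_def using X x(1) by (intro sum_adj_remove G) auto
  moreover have "X - S - {x} = X - insert x S" by auto
  ultimately have e: "e2 (X - S) = e2 (X - insert x S) + 2 * deg x" by simp
  have e_nonneg: "e2 Y \<ge> 0" for Y by (simp add: e2_def adj_def sum_nonneg)
  have "e2 X * ((q - 1) * (q - 2)) \<le> e2 (X - insert x S) * (d * (d - 1))"
  \<comment> \<open>For \<open>q = 1\<close> the factor \<open>q - 2\<close> is negative, so the
    estimate of the other case fails; but then the left side is 0.\<close>
  proof (cases "q = 1")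
    case True
    then show ?thesis using e_nonneg[of "X - insert x S"] q Suc.prems
      by (simp add: d_def)
  next
    case False
    with q have q2: "q \<ge> 2" by simp
    have "q * (e2 X * ((q - 1) * (q - 2))) = (q - 2) * (e2 X * (q * (q - 1)))" by algebra
    also have "\<dots> \<le> (q - 2) * (e2 (X - S) * (d * (d - 1)))"
      using S(3) q2 unfolding q_def[symmetric] by (intro mult_left_mono) auto
    also have "\<dots> = ((q - 2) * e2 (X - S)) * (d * (d - 1))" by simp
    also have "\<dots> \<le> (q * e2 (X - insert x S)) * (d * (d - 1))"
    proof (rule mult_right_mono)
      \<comment> \<open>Removing \<open>x\<close> costs \<open>2 * deg x\<close>, and
        \<open>q * deg x\<close> is at most \<open>e2 (X - S)\<close>.\<close>
      show "(q - 2) * e2 (X - S) \<le> q * e2 (X - insert x S)"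
        using qd e by (simp add: algebra_simps)
      show "0 \<le> d * (d - 1)" using Suc.prems by (simp add: d_def)
    qed
    finally show ?thesis using q2 by (simp add: mult.assoc)
  qed
  moreover have "card (insert x S) = Suc j" "insert x S \<subseteq> N" using S x fin by auto
  ultimately show ?case by (intro exI[of _ "insert x S"]) (auto simp: q_def algebra_simps)
qed

text \<open>
  Pair the two vertices with the largest values of \<open>d\<close>, give them opposite signs and recurse:
  \<open>\<bar>\<Sum>d s\<bar>\<close> telescopes, and the free choice of the orientation of each pair makes the
  contribution of the edges between different pairs nonnegative.
\<close>

lemma exists_balanced_signs:
  fixes d :: "'a \<Rightarrow> int"
  assumes G: "simple_graph G" and "finite V" "\<And>v. v \<in> V \<Longrightarrow> 0 \<le> d v \<and> d v \<le> D" "0 \<le> D"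
  shows "\<exists>s M. (\<forall>v. s v = 1 \<or> s v = -1) \<and> \<bar>\<Sum>v\<in>V. d v * s v\<bar> \<le> D \<and>
    M \<subseteq> edges_in G V \<and> pairwise disjnt M \<and> - 2 * int (card M) \<le> (\<Sum>u\<in>V. \<Sum>v\<in>V. adj G u v * (s u * s v))"
  using assms(2-)
\<comment> \<open>\<open>D\<close> must vary: the remaining vertices are treated with the bound
  \<open>d b\<close>, the value at the second vertex of the pair.\<close>
proof (induction "card V" arbitrary: V D rule: less_induct)
  case less
  show ?case
  proof (cases "card V \<le> 1")
    case True
    then consider "V = {}" | v where "V = {v}"
      using less.prems(1) by (metis card_le_Suc0_iff_eq One_nat_def is_singletonI' is_singletonE)
    then show ?thesis
    proof cases
      case 1
      then show ?thesis using less.prems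
        by (intro exI[of _ "\<lambda>_. 1"] exI[of _ "{}"]) simp
    next
      case 2
      then show ?thesis using less.prems
        by (intro exI[of _ "\<lambda>_. 1"] exI[of _ "{}"]) (simp add: adj_irrefl G)
    qed
  next
    case False
    have top: "\<exists>a\<in>U. \<forall>y\<in>U. d y \<le> d a" if "U \<noteq> {}" "finite U" for U
      using ex_is_arg_min_if_finite[of U "\<lambda>x. - d x"] that by (auto simp: is_arg_min_linorder)
    have "V \<noteq> {}" using False by auto
    then obtain a where a: "a \<in> V" "\<forall>y\<in>V. d y \<le> d a" using top less.prems(1) by blast
    have "V - {a} \<noteq> {}" using False a(1) less.prems(1)
      by (metis card.empty card_Suc_Diff1 One_nat_def order_refl)
    then obtain b where b: "b \<in> V - {a}" "\<forall>y\<in>V - {a}. d y \<le> d b"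
      using top[of "V - {a}"] less.prems(1) by auto
    define U where "U = V - {a} - {b}"
    have V: "V = insert a (insert b U)" "a \<notin> insert b U" "b \<notin> U" "finite U"
      using a b less.prems(1) by (auto simp: U_def)
    have "card U < card V" using V by simp
    moreover have "\<And>v. v \<in> U \<Longrightarrow> 0 \<le> d v \<and> d v \<le> d b" "0 \<le> d b"
      using b less.prems(2) by (auto simp: U_def)
    ultimately obtain s M where s: "\<forall>v. s v = 1 \<or> s v = -1" "\<bar>\<Sum>v\<in>U. d v * s v\<bar> \<le> d b"
      and M: "M \<subseteq> edges_in G U" "pairwise disjnt M"
      and Q: "- 2 * int (card M) \<le> (\<Sum>u\<in>U. \<Sum>v\<in>U. adj G u v * (s u * s v))"
      using less.hyps[OF _ V(4)] by blast
    \<comment> \<open>Half of the contribution of the edges between \<open>{a, b}\<close> and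
      \<open>U\<close> when \<open>a\<close> gets 1 and \<open>b\<close> gets -1. Swapping the two
      signs negates it, so \<sigma> can make it nonnegative.\<close>
    define g where "g = (\<Sum>v\<in>U. (adj G a v - adj G b v) * s v)"
    define \<sigma> :: int where "\<sigma> = (if g \<ge> 0 then 1 else -1)"
    define s' where "s' = s(a := \<sigma>, b := -\<sigma>)"
    \<comment> \<open>An edge between \<open>a\<close> and \<open>b\<close> is the only new negative
      contribution; adding it to the matching pays for it.\<close>
    define M' where "M' = (if {a, b} \<in> edges G then insert {a, b} M else M)"
    have sU: "s' v = s v" if "v \<in> U" for v using that V by (auto simp: s'_def)
    have sa: "s' a = \<sigma>" "s' b = -\<sigma>" using V by (auto simp: s'_def)
    have finM: "finite M" using M(1) finite_edges_in[OF G] finite_subset by blast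
    have "{a, b} \<notin> M" using M(1) V by (auto simp: edges_in_def)
    then have cM': "int (card M') = int (card M) + adj G a b"
      using finM by (simp add: M'_def adj_def)
    have "M' \<subseteq> edges_in G V" using M(1) V(1) by (auto simp: M'_def edges_in_def)
    moreover have "pairwise disjnt M'"
      using M V unfolding M'_def by (auto simp: pairwise_insert disjnt_def edges_in_def)
    moreover have "\<bar>\<Sum>v\<in>V. d v * s' v\<bar> \<le> D"
    proof -
      \<comment> \<open>The pair contributes \<open>d a - d b\<close> in absolute value and the rest
        at most \<open>d b\<close>, so the total is at most \<open>d a\<close>.\<close>
      have "(\<Sum>v\<in>V. d v * s' v) = \<sigma> * (d a - d b) + (\<Sum>v\<in>U. d v * s v)"
        using V sU by (simp add: sa algebra_simps)
      moreover have "\<bar>\<sigma> * (d a - d b)\<bar> = d a - d b" using a b by (auto simp: \<sigma>_def)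
      ultimately have "\<bar>\<Sum>v\<in>V. d v * s' v\<bar> \<le> d a" using s(2) by linarith
      then show ?thesis using less.prems(2)[OF a(1)] by linarith
    qed
    moreover have "- 2 * int (card M') \<le> (\<Sum>u\<in>V. \<Sum>v\<in>V. adj G u v * (s' u * s' v))"
    proof -
      let ?f = "\<lambda>u v. adj G u v * (s' u * s' v)"
      have sym: "?f u v = ?f v u" for u v by (simp add: adj_commute[of G u v])
      have "(\<Sum>u\<in>V. \<Sum>v\<in>V. ?f u v) = ?f a a + ?f a b + ?f b a + ?f b b
          + (\<Sum>v\<in>U. ?f a v) + (\<Sum>v\<in>U. ?f b v) + (\<Sum>u\<in>U. ?f u a) + (\<Sum>u\<in>U. ?f u b)
          + (\<Sum>u\<in>U. \<Sum>v\<in>U. ?f u v)"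
        using V by (simp add: sum.distrib)
      also have "(\<Sum>u\<in>U. ?f u a) = (\<Sum>v\<in>U. ?f a v)" by (intro sum.cong sym refl)
      also have "(\<Sum>u\<in>U. ?f u b) = (\<Sum>v\<in>U. ?f b v)" by (intro sum.cong sym refl)
      also have "?f b a = ?f a b" by (rule sym)
      also have "?f a b = - adj G a b" by (auto simp: sa \<sigma>_def)
      also have "?f a a = 0" by (simp add: adj_irrefl G)
      also have "?f b b = 0" by (simp add: adj_irrefl G)
      also have "(\<Sum>u\<in>U. \<Sum>v\<in>U. ?f u v) = (\<Sum>u\<in>U. \<Sum>v\<in>U. adj G u v * (s u * s v))"
        by (simp add: sU)
      finally have "(\<Sum>u\<in>V. \<Sum>v\<in>V. ?f u v) = - 2 * adj G a b
          + 2 * ((\<Sum>v\<in>U. ?f a v) + (\<Sum>v\<in>U. ?f b v))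
          + (\<Sum>u\<in>U. \<Sum>v\<in>U. adj G u v * (s u * s v))" by simp
      moreover have "(\<Sum>v\<in>U. ?f a v) + (\<Sum>v\<in>U. ?f b v) = \<sigma> * g"
        unfolding g_def sum_distrib_left sum.distrib[symmetric]
        by (intro sum.cong refl) (simp add: sa sU algebra_simps)
      moreover have "\<sigma> * g \<ge> 0" by (auto simp: \<sigma>_def)
      \<comment> \<open>The final arithmetic is stated with variables in place of the large
        sums.\<close>
      moreover have "x = - 2 * e + 2 * y + z \<Longrightarrow> y = w \<Longrightarrow> 0 \<le> w \<Longrightarrow> - 2 * n \<le> z \<Longrightarrow>
          n' = n + e \<Longrightarrow> - 2 * n' \<le> x" for x y z w e n n' :: int by linarith
      ultimately show ?thesis using Q cM' by blast
    qed
    moreover have "\<forall>v. s' v = 1 \<or> s' v = -1" using s(1) by (auto simp: s'_def \<sigma>_def)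
    ultimately show ?thesis by blast
  qed
qed

text \<open>Edges of a matching share no vertices, so the endpoints of any \<open>k\<close> of them
  are disjoint from the endpoints of the others.\<close>

lemma LCP_2_if_matching:
  assumes G: "simple_graph G" and M: "M \<subseteq> edges G" "pairwise disjnt M" "2 * k \<le> card M"
  shows "G \<in> LCP 2 k"
proof -
  obtain K where K: "K \<subseteq> M" "card K = k"
    using obtain_subset_with_card_n[of k M] M(3) by (metis le_add1 mult_2 order_trans)
  have finM: "finite M" using M(1) simple_graphD(2)[OF G] finite_subset by blast
  have "card K \<le> card (edges_in G (\<Union>K))"
    using K M by (intro card_mono finite_edges_in G) (auto simp: edges_in_def)
  moreover have "card (M - K) \<le> card (edges_in G (\<Union>(M - K)))"
    using M by (intro card_mono finite_edges_in G) (auto simp: edges_in_def)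
  moreover have "card (M - K) = card M - k"
    using K finM by (simp add: card_Diff_subset finite_subset[OF K(1)])
  moreover have "\<Union>K \<inter> \<Union>(M - K) = {}"
  proof (rule equals0I)
    fix x assume "x \<in> \<Union>K \<inter> \<Union>(M - K)"
    then obtain a b where "a \<in> K" "b \<in> M - K" "x \<in> a" "x \<in> b" by blast
    moreover from this have "disjnt a b" using M(2) K(1) by (auto intro: pairwiseD)
    ultimately show False by (auto simp: disjnt_def)
  qed
  ultimately show ?thesis
    unfolding LCP_2_iff[OF G] using M(3) K(2)
    by (intro exI[of _ "\<Union>K"] exI[of _ "\<Union>(M - K)"]) auto
qed

lemma LCP_2_if_bounded_degree:
  assumes G: "simple_graph G" and m: "8 * k \<le> card (edges G)"
    and deg: "\<And>u. u \<in> verts G \<Longrightarrow> card (neighbors G u) \<le> 2 * k + 1"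
  shows "G \<in> LCP 2 k"
proof -
  let ?V = "verts G"
  define d where "d = (\<lambda>v. int (card (neighbors G v)))"
  have fin: "finite ?V" using G by (rule simple_graphD)
  obtain s M where s: "\<And>v. s v = 1 \<or> s v = -1" "\<bar>\<Sum>v\<in>?V. d v * s v\<bar> \<le> 2 * int k + 1"
    and M: "M \<subseteq> edges_in G ?V" "pairwise disjnt M"
    and Q: "- 2 * int (card M) \<le> (\<Sum>u\<in>?V. \<Sum>v\<in>?V. adj G u v * (s u * s v))"
    using exists_balanced_signs[OF G fin, of d "2 * int k + 1"] deg by (force simp: d_def)
  show ?thesis
  proof (cases "2 * k \<le> card M")
    case True
    then show ?thesis using LCP_2_if_matching[OF G _ M(2)] M(1) by (simp add: edges_in_verts G)
  next
    case False
    have bound: "k \<le> card (edges_in G {v \<in> ?V. s v = t})" if t: "t = 1 \<or> t = -1" for t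
    proof -
      let ?A = "{v \<in> ?V. s v = t}"
      \<comment> \<open>The indicator of a sign class is \<open>(1 + t * s v) / 2\<close>;
        multiplying two of them out yields the edge number, two equal degree sums and the sum of
        sign products.\<close>
      have ind: "2 * of_bool (s v = t) = 1 + t * s v" for v using s(1)[of v] t by auto
      have "(\<Sum>u\<in>?A. \<Sum>v\<in>?A. adj G u v) =
          (\<Sum>u\<in>?A. \<Sum>v\<in>?V. adj G u v * of_bool (s v = t))"
        using fin by (intro sum.cong refl sum.mono_neutral_cong_left) auto
      also have "\<dots> = (\<Sum>u\<in>?V. \<Sum>v\<in>?V. adj G u v * of_bool (s u = t) * of_bool (s v = t))"
        using fin by (intro sum.mono_neutral_cong_left) auto
      finally have "4 * (\<Sum>u\<in>?A. \<Sum>v\<in>?A. adj G u v) =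
          (\<Sum>u\<in>?V. \<Sum>v\<in>?V. adj G u v * (2 * of_bool (s u = t)) * (2 * of_bool (s v = t)))"
        by (simp only: sum_distrib_left) (intro sum.cong refl, simp)
      also have "\<dots> = (\<Sum>u\<in>?V. \<Sum>v\<in>?V. adj G u v + t * (adj G u v * s u) + t * (adj G u v * s v)
          + adj G u v * (s u * s v))"
        unfolding ind using t by (intro sum.cong refl) (auto simp: algebra_simps)
      also have "\<dots> = (\<Sum>u\<in>?V. \<Sum>v\<in>?V. adj G u v) + t * (\<Sum>u\<in>?V. \<Sum>v\<in>?V. adj G u v * s u)
          + t * (\<Sum>u\<in>?V. \<Sum>v\<in>?V. adj G u v * s v) + (\<Sum>u\<in>?V. \<Sum>v\<in>?V. adj G u v * (s u * s v))"
        by (simp add: sum.distrib sum_distrib_left)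
      also have "(\<Sum>u\<in>?V. \<Sum>v\<in>?V. adj G u v * s v) = (\<Sum>u\<in>?V. \<Sum>v\<in>?V. adj G u v * s u)"
        by (subst sum.swap) (simp add: adj_commute)
      also have "(\<Sum>u\<in>?V. \<Sum>v\<in>?V. adj G u v * s u) = (\<Sum>v\<in>?V. d v * s v)"
        by (simp add: sum_distrib_right[symmetric] sum_adj_eq_degree G d_def)
      also have "(\<Sum>u\<in>?A. \<Sum>v\<in>?A. adj G u v) = 2 * int (card (edges_in G ?A))"
        using fin by (intro sum_adj_eq_card_edges_in G) auto
      also have "(\<Sum>u\<in>?V. \<Sum>v\<in>?V. adj G u v) = 2 * int (card (edges G))"
        using fin by (simp add: sum_adj_eq_card_edges_in G edges_in_verts)
      finally have "8 * int (card (edges_in G ?A)) = 2 * int (card (edges G))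
          + 2 * (t * (\<Sum>v\<in>?V. d v * s v)) + (\<Sum>u\<in>?V. \<Sum>v\<in>?V. adj G u v * (s u * s v))"
        by simp
      moreover have "\<bar>t * (\<Sum>v\<in>?V. d v * s v)\<bar> \<le> 2 * int k + 1" using s(2) t by auto
      \<comment> \<open>As \<open>card M\<close> is at most \<open>2 * k - 1\<close>, the right side
        is at least \<open>16 * k - 2 * (2 * k + 1) - 2 * (2 * k - 1) = 8 * k\<close>.\<close>
      ultimately show ?thesis using Q m False by linarith
    qed
    show ?thesis unfolding LCP_2_iff[OF G]
      using bound[of 1] bound[of "-1"]
      by (intro exI[of _ "{v \<in> ?V. s v = 1}"] exI[of _ "{v \<in> ?V. s v = -1}"]) auto
  qed
qed

text \<open>The star from \<open>u\<close> to the removed set \<open>S\<close> is one class; the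
  edges surviving outside \<open>u\<close> and \<open>S\<close> form the other.\<close>

lemma LCP_2_if_medium_degree:
  assumes G: "simple_graph G" and m: "8 * k \<le> card (edges G)" and u: "u \<in> verts G"
    and d: "2 * k + 2 \<le> card (neighbors G u)" "card (neighbors G u) < 3 * k"
  shows "G \<in> LCP 2 k"
proof -
  let ?X = "verts G - {u}" and ?N = "neighbors G u"
  define d where "d = int (card ?N)"
  have fin: "finite ?X" using G by (simp add: simple_graphD)
  have NX: "?N \<subseteq> ?X" using not_loop[OF G] by (auto simp: neighbors_def)
  have "k \<le> card ?N" using d by simp
  from exists_sparse_removal[OF G fin NX this] obtain S where S: "S \<subseteq> ?N" "card S = k"
    and le: "int (card (edges_in G ?X)) * ((d - int k) * (d - int k - 1))
      \<le> int (card (edges_in G (?X - S))) * (d * (d - 1))"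
    using fin by (auto simp: sum_adj_eq_card_edges_in G d_def mult.assoc)
  define T where "T = (d - int k) * (d - int k - 1)"
  have T: "T > 0" using d by (simp add: T_def d_def)
  \<comment> \<open>From \<open>d >= 2 * k + 2\<close>, both \<open>d <= 2 * (d - k)\<close> and
    \<open>d - 1 <= 2 * (d - k - 1)\<close>; this is the survival fraction
    \<open>1/4\<close>.\<close>
  have "d * (d - 1) \<le> (2 * (d - int k)) * (2 * (d - int k - 1))"
    using d by (intro mult_mono) (auto simp: d_def)
  also have "\<dots> = 4 * T" by (simp add: T_def algebra_simps)
  finally have dT: "d * (d - 1) \<le> 4 * T" .
  \<comment> \<open>Of at least \<open>8 * k\<close> edges, at most \<open>3 * k - 1\<close> meet
    \<open>u\<close>.\<close>
  have "5 * int k + 1 \<le> int (card (edges_in G ?X))"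
    using card_edges_remove[OF G u] m d by linarith
  then have "(5 * int k + 1) * T \<le> int (card (edges_in G ?X)) * T"
    using T by (intro mult_right_mono) auto
  also have "\<dots> \<le> int (card (edges_in G (?X - S))) * (4 * T)"
    using le dT T unfolding T_def[symmetric] by (meson mult_left_mono of_nat_0_le_iff order_trans)
  finally have "(5 * int k + 1) * T \<le> (4 * int (card (edges_in G (?X - S)))) * T" by simp
  then have "5 * int k + 1 \<le> 4 * int (card (edges_in G (?X - S)))"
    using T by (simp only: mult_le_cancel_right)
  then have "k \<le> card (edges_in G (?X - S))" by linarith
  moreover have "k \<le> card (edges_in G (insert u S))"
    using star_card_edges_in[OF G S(1)] S(2) by auto
  ultimately show ?thesis
    unfolding LCP_2_iff[OF G] by (intro exI[of _ "?X - S"] exI[of _ "insert u S"]) auto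
qed

text \<open>\<open>B\<close> is grown edge by edge with at most two new vertices per edge, each time
  from a neighbor of \<open>u\<close> that is not a leaf. The \<open>k\<close> neighbors of
  \<open>u\<close> left outside \<open>B\<close> give the other class.\<close>

lemma LCP_2_if_large_degree:
  assumes G: "simple_graph G" and u: "u \<in> verts G"
    and pend: "card (pendants G u) < k" and d: "3 * k \<le> card (neighbors G u)"
  shows "G \<in> LCP 2 k"
proof -
  let ?N = "neighbors G u"
  have finN: "finite ?N" by (rule finite_neighbors[OF G])
  have "\<exists>B. u \<notin> B \<and> finite B \<and> card B \<le> 2 * j \<and> j \<le> card (edges_in G B)" if "j \<le> k" for j
    using that
  proof (induction j)
    case 0
    then show ?case by (intro exI[of _ "{}"]) simp
  next
    case (Suc j)
    then obtain B where B: "u \<notin> B" "finite B" "card B \<le> 2 * j" "j \<le> card (edges_in G B)"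
      by auto
    \<comment> \<open>Leaves and \<open>B\<close> together have at most
      \<open>(k - 1) + 2 * (k - 1)\<close> elements, fewer than the degree of
      \<open>u\<close>.\<close>
    have "\<not> ?N \<subseteq> pendants G u \<union> B"
    proof
      assume "?N \<subseteq> pendants G u \<union> B"
      then have "card ?N \<le> card (pendants G u \<union> B)"
        using B finN by (intro card_mono) (auto simp: pendants_def)
      also have "\<dots> \<le> card (pendants G u) + card B" by (rule card_Un_le)
      finally show False using d pend B(3) Suc.prems by linarith
    qed
    then obtain x where x: "x \<in> ?N" "x \<notin> B" "neighbors G x \<noteq> {u}" by (auto simp: pendants_def)
    have "u \<in> neighbors G x" using x(1) by (simp add: neighbors_iff G insert_commute)
    then obtain y where y: "y \<in> neighbors G x" "y \<noteq> u" using x(3) by blast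
    have xu: "x \<noteq> u" using x(1) not_loop[OF G] by (auto simp: neighbors_def)
    \<comment> \<open>The edge is new because \<open>x\<close> lies outside \<open>B\<close>;
      \<open>y\<close> may already belong to \<open>B\<close>.\<close>
    have "{x, y} \<in> edges_in G (insert x (insert y B))" "{x, y} \<notin> edges_in G B"
      using y x(2) by (auto simp: edges_in_def neighbors_iff G)
    then have "insert {x, y} (edges_in G B) \<subseteq> edges_in G (insert x (insert y B))"
      and c: "card (insert {x, y} (edges_in G B)) = Suc (card (edges_in G B))"
      using edges_in_mono[of B "insert x (insert y B)" G] finite_edges_in[OF G]
      by (auto simp: card_insert_if)
    then have "Suc j \<le> card (edges_in G (insert x (insert y B)))"
      using B(4) card_mono[OF finite_edges_in[OF G]] by (metis Suc_le_mono order_trans)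
    moreover have "card (insert x (insert y B)) \<le> 2 * Suc j"
      using B(2,3) by (simp add: card_insert_if)
    ultimately show ?case using B xu y by (intro exI[of _ "insert x (insert y B)"]) auto
  qed
  then obtain B where B: "u \<notin> B" "finite B" "card B \<le> 2 * k" "k \<le> card (edges_in G B)"
    by blast
  have "k \<le> card (?N - B)"
    using diff_card_le_card_Diff[OF B(2), of ?N] d B(3) by linarith
  also have "\<dots> \<le> card (edges_in G (insert u (?N - B)))"
    by (rule star_card_edges_in[OF G, of _ u]) auto
  finally show ?thesis
    unfolding LCP_2_iff[OF G] using B by (intro exI[of _ "insert u (?N - B)"] exI[of _ B]) auto
qed

text \<open>A single vertex of degree at least \<open>2 * k + 2\<close> allows a star construction,
  chosen by comparing its degree with \<open>3 * k\<close>. Without such a vertex the sign argument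
  applies.\<close>

theorem LCP_2_if_few_pendants:
  assumes G: "simple_graph G" and m: "8 * k \<le> card (edges G)"
    and pend: "\<And>u. u \<in> verts G \<Longrightarrow> card (pendants G u) < k"
  shows "G \<in> LCP 2 k"
proof (cases "\<exists>u\<in>verts G. 2 * k + 2 \<le> card (neighbors G u)")
  case True
  then obtain u where "u \<in> verts G" "2 * k + 2 \<le> card (neighbors G u)" by blast
  then show ?thesis
    using LCP_2_if_medium_degree[OF G m] LCP_2_if_large_degree[OF G] pend by (metis not_less)
next
  case False
  then show ?thesis by (intro LCP_2_if_bounded_degree[OF G m]) force
qed

text \<open>Otherwise \<open>u\<close> and its leaves form an obstacle with \<open>V1 = {u}\<close>,
  the leaves serving both as \<open>V2\<close> and as the set assigned to \<open>u\<close>.\<close>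

lemma card_pendants_less_if_reduced:
  assumes G: "simple_graph G" and red: "reduced 2 k G" and u: "u \<in> verts G"
  shows "card (pendants G u) < k"
proof (rule ccontr)
  assume "\<not> card (pendants G u) < k"
  then have "obstacle 1 k G {u} (pendants G u)"
    using u not_loop[OF G] unfolding obstacle_def
    by (intro conjI exI[of _ "\<lambda>_. pendants G u"]) (auto simp: pendants_def neighbors_def)
  moreover have "(1 :: nat) < 2" by simp
  ultimately show False using red unfolding reduced_def by blast
qed

section \<open>Total correctness with time bounds\<close>

section \<open>Verifying programs\<close>

definition runs :: "com \<Rightarrow> state \<Rightarrow> nat \<Rightarrow> (state \<Rightarrow> bool) \<Rightarrow> bool" where
  "runs c s T Q \<longleftrightarrow> (\<exists>t s'. exec c s t s' \<and> t \<le> T \<and> Q s')"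

lemma runs_mono: "runs c s T Q \<Longrightarrow> T \<le> T' \<Longrightarrow> (\<And>s'. Q s' \<Longrightarrow> Q' s') \<Longrightarrow> runs c s T' Q'"
  unfolding runs_def by (meson order_trans)

lemma runs_Seq:
  "runs c s T P \<Longrightarrow> (\<And>s'. P s' \<Longrightarrow> runs d s' U Q) \<Longrightarrow> runs (Seq c d) s (T + U) Q"
  unfolding runs_def by (meson exec.Seq add_mono)

text \<open>The invariant is indexed by the number of finished rounds. Each round costs the body and
  one test, and the final \<open>+ 1\<close> is the failing test. The induction goes down from the
  exit \<open>i = N\<close>.\<close>

lemma runs_WhileLess:
  assumes body: "\<And>i s. i < N \<Longrightarrow> I i s \<Longrightarrow> fst s a < fst s b \<and> runs c s T (I (Suc i))"
    and final: "\<And>s. I N s \<Longrightarrow> \<not> fst s a < fst s b"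
    and init: "I 0 s"
  shows "runs (WhileLess a b c) s (N * (T + 1) + 1) (I N)"
proof -
  have "runs (WhileLess a b c) s ((N - i) * (T + 1) + 1) (I N)" if "i \<le> N" "I i s" for i s
    using that
  proof (induction i arbitrary: s rule: inc_induct)
    case base
    then show ?case unfolding runs_def using exec.WhileFalse[OF final, of s]
      by (intro exI[of _ 1] exI[of _ s]) auto
  next
    case (step i)
    then obtain t s' where t: "exec c s t s'" "t \<le> T" "I (Suc i) s'" "fst s a < fst s b"
      using body[OF step.hyps(2) step.prems] unfolding runs_def by blast
    then obtain u s'' where u: "exec (WhileLess a b c) s' u s''"
      "u \<le> (N - Suc i) * (T + 1) + 1" "I N s''"
      using step.IH[OF t(3)] unfolding runs_def by blast
    have "N - i = Suc (N - Suc i)" using step.hyps by simp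
    then have "Suc (t + u) \<le> (N - i) * (T + 1) + 1" using t(2) u(2) by simp
    then show ?case unfolding runs_def using exec.WhileTrue[OF t(4,1) u(1)] u(3)
      by (intro exI[of _ "Suc (t + u)"] exI[of _ s''] conjI)
  qed
  from this[of 0] init show ?thesis by simp
qed

text \<open>Code without loops always halts, so it can be verified by evaluating
  \<open>effect\<close>; only loops require invariants.\<close>

fun loop_free :: "com \<Rightarrow> bool" where
  "loop_free (Seq c d) \<longleftrightarrow> loop_free c \<and> loop_free d"
| "loop_free (IfLess a b c d) \<longleftrightarrow> loop_free c \<and> loop_free d"
| "loop_free (WhileLess a b c) \<longleftrightarrow> False"
| "loop_free _ \<longleftrightarrow> True"

text \<open>The value for \<open>WhileLess\<close> is a dummy; the function is meaningful for
  \<open>loop_free\<close> programs.\<close>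

fun effect :: "com \<Rightarrow> state \<Rightarrow> state" where
  "effect (Const r n) (R, M) = (R(r := n), M)"
| "effect (Add r a b) (R, M) = (R(r := R a + R b), M)"
| "effect (Sub r a b) (R, M) = (R(r := R a - R b), M)"
| "effect (Load r a) (R, M) = (R(r := M (R a)), M)"
| "effect (Store a b) (R, M) = (R, M(R a := R b))"
| "effect (Seq c d) s = effect d (effect c s)"
| "effect (IfLess a b c d) s = (if fst s a < fst s b then effect c s else effect d s)"
| "effect (WhileLess a b c) s = s"

text \<open>An upper bound independent of the state: a branching counts its longer branch.\<close>

fun steps :: "com \<Rightarrow> nat" where
  "steps (Seq c d) = steps c + steps d"
| "steps (IfLess a b c d) = Suc (max (steps c) (steps d))"
| "steps _ = 1"

lemma exec_loop_free: "loop_free c \<Longrightarrow> \<exists>t\<le>steps c. exec c s t (effect c s)"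
proof (induction c arbitrary: s)
  case (Seq c d)
  then obtain t u where "t \<le> steps c" "exec c s t (effect c s)"
    "u \<le> steps d" "exec d (effect c s) u (effect d (effect c s))"
    by (metis loop_free.simps(1))
  then show ?case by (intro exI[of _ "t + u"]) (auto intro: exec.Seq)
next
  case (IfLess a b c d)
  then obtain t u where "t \<le> steps c" "exec c s t (effect c s)" "u \<le> steps d" "exec d s u (effect d s)"
    by (metis loop_free.simps(2))
  then show ?case
    by (intro exI[of _ "if fst s a < fst s b then Suc t else Suc u"]) (auto intro: exec.intros)
next
  case (WhileLess a b c)
  then show ?case by simp
next
  case (Const r n)
  show ?case by (cases s; simp only: effect.simps steps.simps; blast intro: exec.Const)
next
  case (Add r a b)
  show ?case by (cases s; simp only: effect.simps steps.simps; blast intro: exec.Add)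
next
  case (Sub r a b)
  show ?case by (cases s; simp only: effect.simps steps.simps; blast intro: exec.Sub)
next
  case (Load r a)
  show ?case by (cases s; simp only: effect.simps steps.simps; blast intro: exec.Load)
next
  case (Store a b)
  show ?case by (cases s; simp only: effect.simps steps.simps; blast intro: exec.Store)
qed

lemma runs_loop_free: "loop_free c \<Longrightarrow> Q (effect c s) \<Longrightarrow> runs c s (steps c) Q"
  unfolding runs_def using exec_loop_free by blast

lemma runs_IfLess:
  assumes "fst s a < fst s b \<Longrightarrow> runs c s T Q" "\<not> fst s a < fst s b \<Longrightarrow> runs d s T Q"
  shows "runs (IfLess a b c d) s (Suc T) Q"
  using assms unfolding runs_def by (metis exec.IfTrue exec.IfFalse Suc_le_mono)

text \<open>Registers 20 and 21 are scratch; the empty list writes one of them because there is no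
  empty command.\<close>

fun store_list :: "nat \<Rightarrow> nat list \<Rightarrow> com" where
  "store_list i [] = Const 20 0"
| "store_list i (x # xs) =
    Seq (Seq (Const 20 i) (Seq (Const 21 x) (Store 20 21))) (store_list (Suc i) xs)"

definition holds :: "nat list \<Rightarrow> state \<Rightarrow> bool" where
  "holds xs s \<longleftrightarrow> (\<forall>j<length xs. snd s j = xs ! j)"

lemma effect_store_list:
  "snd (effect (store_list i xs) s) j =
    (if i \<le> j \<and> j < i + length xs then xs ! (j - i) else snd s j)"
proof (induction xs arbitrary: i s)
  case (Cons x xs)
  show ?case by (cases s) (auto simp: Cons nth_Cons' split: if_splits)
next
  case Nil
  then show ?case by (cases s) simp
qed

lemma loop_free_store_list: "loop_free (store_list i xs)"
  by (induction i xs rule: store_list.induct) auto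

lemma steps_store_list: "steps (store_list i xs) = 3 * length xs + 1"
  by (induction i xs rule: store_list.induct) auto

lemma runs_store_list: "runs (store_list 0 xs) s (3 * length xs + 1) (holds xs)"
  using runs_loop_free[OF loop_free_store_list, of "holds xs" 0 xs s]
  by (simp add: steps_store_list holds_def effect_store_list)

section \<open>An in-place kernelization on the adjacency matrix\<close>

section \<open>The kernelization program\<close>

text \<open>
  Registers: 0 and 1 hold these constants, 2 and 3 hold \<open>n\<close> and \<open>k\<close>, 4 holds the address
  \<open>2 + n\<^sup>2\<close> behind the input, where the vertex degrees are stored. In a scan of the matrix,
  5 and 7 hold the row \<open>u\<close> and the column \<open>v\<close>, and 6, 16 and 8 the addresses of the matrix
  entry and of the degrees of \<open>u\<close> and \<open>v\<close>. Register 10 holds the degree sum, 11 the verdict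
  from vertices with many leaves (0: none, 1: no, 2: yes), 14 the output address and 15 the
  number of nonisolated vertices.
\<close>

definition scan :: "com \<Rightarrow> com \<Rightarrow> com \<Rightarrow> com" where
  "scan pre body post =
    Seq (Seq (Const 5 0) (Seq (Const 6 2) (Add 16 4 0)))
      (WhileLess 5 2
        (Seq (Seq pre (Seq (Const 7 0) (Add 8 4 0)))
          (Seq (WhileLess 7 2 (Seq body (Seq (Add 6 6 1) (Seq (Add 8 8 1) (Add 7 7 1)))))
            (Seq post (Seq (Add 16 16 1) (Add 5 5 1))))))"

text \<open>Addresses follow \<open>u\<close> and \<open>v\<close> by increments, since the machine
  cannot multiply. At \<open>v = n\<close> register 6 already points to row
  \<open>u + 1\<close>.\<close>

definition at_entry :: "nat \<Rightarrow> nat \<Rightarrow> nat \<Rightarrow> (nat \<Rightarrow> nat) \<Rightarrow> bool" where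
  "at_entry n u v R \<longleftrightarrow> R 0 = 0 \<and> R 1 = 1 \<and> R 2 = n \<and> R 4 = 2 + n * n \<and>
    R 5 = u \<and> R 6 = 2 + u * n + v \<and> R 7 = v \<and> R 8 = 2 + n * n + v \<and> R 16 = 2 + n * n + u"

definition at_row :: "nat \<Rightarrow> nat \<Rightarrow> (nat \<Rightarrow> nat) \<Rightarrow> bool" where
  "at_row n u R \<longleftrightarrow> R 0 = 0 \<and> R 1 = 1 \<and> R 2 = n \<and> R 4 = 2 + n * n \<and>
    R 5 = u \<and> R 6 = 2 + u * n \<and> R 16 = 2 + n * n + u"

text \<open>\<open>J u\<close> holds before row \<open>u\<close>, and \<open>I u v\<close> before
  entry \<open>v\<close> of it. By \<open>frame\<close> neither depends on the registers moved by
  the scan itself, so increments preserve them. The 4 per entry is three increments and a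
  test.\<close>

lemma runs_scan:
  assumes lf: "loop_free pre" "loop_free body" "loop_free post"
    and frame: "\<And>u R M r x. r \<in> {5, 6, 7, 8, 16} \<Longrightarrow> J u (R(r := x)) M = J u R M"
      "\<And>u v R M r x. r \<in> {5, 6, 7, 8, 16} \<Longrightarrow> I u v (R(r := x)) M = I u v R M"
    and pre: "\<And>u R M. u < n \<Longrightarrow> at_row n u R \<Longrightarrow> J u R M \<Longrightarrow>
      (case effect pre (R, M) of (R', M') \<Rightarrow> at_row n u R' \<and> I u 0 R' M')"
    and body: "\<And>u v R M. u < n \<Longrightarrow> v < n \<Longrightarrow> at_entry n u v R \<Longrightarrow> I u v R M \<Longrightarrow>
      (case effect body (R, M) of (R', M') \<Rightarrow> at_entry n u v R' \<and> I u (Suc v) R' M')"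
    and post: "\<And>u R M. u < n \<Longrightarrow> at_entry n u n R \<Longrightarrow> I u n R M \<Longrightarrow>
      (case effect post (R, M) of (R', M') \<Rightarrow> at_entry n u n R' \<and> J (Suc u) R' M')"
    and init: "R 0 = 0" "R 1 = 1" "R 2 = n" "R 4 = 2 + n * n" "J 0 R M"
  shows "runs (scan pre body post) (R, M)
    (n * (n * (steps body + 4) + steps pre + steps post + 6) + 4) (\<lambda>(R, M). at_row n n R \<and> J n R M)"
proof -
  let ?row = "\<lambda>u (R, M). at_row n u R \<and> J u R M"
  let ?entry = "\<lambda>u v (R, M). at_entry n u v R \<and> I u v R M"
  let ?body = "Seq body (Seq (Add 6 6 1) (Seq (Add 8 8 1) (Add 7 7 1)))"
  have row: "runs (Seq (Seq pre (Seq (Const 7 0) (Add 8 4 0)))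
          (Seq (WhileLess 7 2 ?body) (Seq post (Seq (Add 16 16 1) (Add 5 5 1)))))
      s (n * (steps body + 4) + steps pre + steps post + 5) (?row (Suc u))"
    if u: "u < n" and s: "?row u s" for u s
  proof -
    have "runs (Seq pre (Seq (Const 7 0) (Add 8 4 0))) s
        (steps (Seq pre (Seq (Const 7 0) (Add 8 4 0)))) (?entry u 0)"
    proof (rule runs_loop_free)
      obtain R M where [simp]: "s = (R, M)" by (cases s)
      obtain R' M' where e: "effect pre (R, M) = (R', M')" by (cases "effect pre (R, M)")
      have "at_row n u R' \<and> I u 0 R' M'" using pre[of u R M] u s e by auto
      then show "?entry u 0 (effect (Seq pre (Seq (Const 7 0) (Add 8 4 0))) s)"
        by (simp add: e frame at_row_def at_entry_def)
    qed (simp add: lf)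
    then have 1: "runs (Seq pre (Seq (Const 7 0) (Add 8 4 0))) s (steps pre + 2) (?entry u 0)"
      by simp
    have 2: "runs (WhileLess 7 2 ?body) s' (n * (steps body + 3 + 1) + 1) (?entry u n)"
      if s': "?entry u 0 s'" for s'
    proof (rule runs_WhileLess[where I = "?entry u"])
      fix v s assume v: "v < n" "?entry u v s"
      obtain R M where [simp]: "s = (R, M)" by (cases s)
      obtain R' M' where e: "effect body (R, M) = (R', M')" by (cases "effect body (R, M)")
      have en: "at_entry n u v R' \<and> I u (Suc v) R' M'" using body[of u v R M] u v e by auto
      have "runs ?body s (steps ?body) (?entry u (Suc v))"
        using en by (intro runs_loop_free) (simp_all add: lf e frame at_entry_def)
      then show "fst s 7 < fst s 2 \<and> runs ?body s (steps body + 3) (?entry u (Suc v))"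
        using v by (simp add: at_entry_def eval_nat_numeral)
    qed (use s' in \<open>auto simp: at_entry_def\<close>)
    have 3: "runs (Seq post (Seq (Add 16 16 1) (Add 5 5 1))) s' (steps post + 2) (?row (Suc u))"
      if s': "?entry u n s'" for s'
    proof -
      obtain R M where [simp]: "s' = (R, M)" by (cases s')
      obtain R' M' where e: "effect post (R, M) = (R', M')" by (cases "effect post (R, M)")
      have "at_entry n u n R' \<and> J (Suc u) R' M'" using post[of u R M] u s' e by auto
      then have "runs (Seq post (Seq (Add 16 16 1) (Add 5 5 1))) s'
          (steps (Seq post (Seq (Add 16 16 1) (Add 5 5 1)))) (?row (Suc u))"
        by (intro runs_loop_free) (simp_all add: lf e frame at_entry_def at_row_def)
      then show ?thesis by simp
    qed
    show ?thesis
      by (rule runs_mono[OF runs_Seq[OF 1 runs_Seq[OF 2 3]]]) auto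
  qed
  have 1: "runs (Seq (Const 5 0) (Seq (Const 6 2) (Add 16 4 0))) (R, M) 3 (?row 0)"
    using runs_loop_free[of "Seq (Const 5 0) (Seq (Const 6 2) (Add 16 4 0))" "?row 0" "(R, M)"]
      init by (simp add: frame at_row_def eval_nat_numeral)
  show ?thesis
    unfolding scan_def
  proof (rule runs_mono[OF runs_Seq[OF 1 runs_WhileLess[where I = "?row"]]])
    fix i s assume i: "i < n" "?row i s"
    show "fst s 5 < fst s 2 \<and> runs (Seq (Seq pre (Seq (Const 7 0) (Add 8 4 0)))
          (Seq (WhileLess 7 2 ?body) (Seq post (Seq (Add 16 16 1) (Add 5 5 1)))))
      s (n * (steps body + 4) + steps pre + steps post + 5) (?row (Suc i))"
      using row[OF i] i by (auto simp: at_row_def)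
  qed (auto simp: at_row_def)
qed

text \<open>Stands in for an empty command by clearing a scratch register.\<close>

definition skip :: com where "skip = Const 12 0"

text \<open>Two disjoint edges on four vertices, with parameter 1.\<close>

definition yes_code :: "nat list" where
  "yes_code = [4, 1,  0, 1, 0, 0,  1, 0, 0, 0,  0, 0, 0, 1,  0, 0, 1, 0]"

definition no_code :: "nat list" where
  "no_code = [0, 1]"

definition degree_scan :: com where
  "degree_scan = scan (Const 9 0) (Seq (Load 12 6) (Add 9 9 12))
    (Seq (Store 16 9) (Seq (Add 10 10 9) (IfLess 0 9 (Add 15 15 1) skip)))"

text \<open>Register 13 becomes \<open>2 * (d + k)\<close> for the degree \<open>d\<close> of
  \<open>u\<close>; comparing it with the degree sum tests whether fewer than \<open>k\<close> edges
  avoid \<open>u\<close>. A later vertex with \<open>k\<close> leaves overwrites the verdict,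
  harmlessly: each such test decides the instance.\<close>

definition pendant_scan :: com where
  "pendant_scan = scan (Const 9 0)
    (Seq (Load 12 6) (Seq (Load 13 8) (IfLess 0 12 (IfLess 1 13 skip (Add 9 9 1)) skip)))
    (IfLess 9 3 skip
      (Seq (Load 13 16) (Seq (Add 13 13 3) (Seq (Add 13 13 13)
        (IfLess 10 13 (Const 11 1) (Const 11 2))))))"

definition compact_scan :: com where
  "compact_scan = scan (Load 9 16)
    (Seq (Load 12 6) (Seq (Load 13 8)
      (IfLess 0 9 (IfLess 0 13 (Seq (Store 14 12) (Add 14 14 1)) skip) skip)))
    skip"

text \<open>Register 4 gets \<open>2 + n * n\<close> by \<open>n\<close> additions, register 13 gets
  \<open>16 * k\<close> by four doublings, to be compared with the degree sum, twice the number of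
  edges. After compaction cell 1 still holds \<open>k\<close>, so of the header only cell 0 is
  rewritten.\<close>

definition kernel_prog :: com where
  "kernel_prog =
    Seq (Seq (Const 1 1) (Seq (Load 2 0) (Seq (Load 3 1) (Const 4 2))))
    (Seq (WhileLess 5 2 (Seq (Add 4 4 2) (Add 5 5 1)))
    (Seq degree_scan
    (Seq pendant_scan
      (IfLess 0 11 (IfLess 1 11 (store_list 0 yes_code) (store_list 0 no_code))
        (Seq (Seq (Add 13 3 3) (Seq (Add 13 13 13) (Seq (Add 13 13 13) (Add 13 13 13))))
          (IfLess 10 13
            (Seq (Const 14 2) (Seq compact_scan (Store 0 15)))
            (store_list 0 yes_code)))))))"

section \<open>Values computed by the scans, with their partial results\<close>

definition row_sum :: "nat \<Rightarrow> (nat \<Rightarrow> nat \<Rightarrow> nat) \<Rightarrow> nat \<Rightarrow> nat" where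
  "row_sum n a u = (\<Sum>v<n. a u v)"

definition leaf_count :: "nat \<Rightarrow> (nat \<Rightarrow> nat \<Rightarrow> nat) \<Rightarrow> nat \<Rightarrow> nat" where
  "leaf_count n a u = length (filter (\<lambda>v. 0 < a u v \<and> row_sum n a v \<le> 1) [0..<n])"

text \<open>The bound \<open>u\<close> makes partial lists available for the loop invariants;
  \<open>u = n\<close> gives all nonisolated vertices.\<close>

definition support :: "nat \<Rightarrow> (nat \<Rightarrow> nat \<Rightarrow> nat) \<Rightarrow> nat \<Rightarrow> nat list" where
  "support n a u = filter (\<lambda>v. 0 < row_sum n a v) [0..<u]"

definition support_rows :: "nat \<Rightarrow> (nat \<Rightarrow> nat \<Rightarrow> nat) \<Rightarrow> nat \<Rightarrow> nat list" where
  "support_rows n a u = concat (map (\<lambda>u. map (a u) (support n a n)) (support n a u))"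

text \<open>The part of the output produced by the first \<open>v\<close> columns of row
  \<open>u\<close>.\<close>

definition row_prefix :: "nat \<Rightarrow> (nat \<Rightarrow> nat \<Rightarrow> nat) \<Rightarrow> nat \<Rightarrow> nat \<Rightarrow> nat list" where
  "row_prefix n a u v = (if 0 < row_sum n a u then map (a u) (support n a v) else [])"

lemma length_support: "length (support n a u) \<le> u"
  using length_filter_le[of _ "[0..<u]"] by (simp add: support_def)

lemma length_row_prefix: "length (row_prefix n a u v) \<le> v"
  by (simp add: row_prefix_def length_support)

lemma support_0 [simp]: "support n a 0 = []"
  and support_Suc: "support n a (Suc u) = support n a u @ (if 0 < row_sum n a u then [u] else [])"
  by (simp_all add: support_def)

lemma support_rows_0 [simp]: "support_rows n a 0 = []"
  and support_rows_Suc: "support_rows n a (Suc u) = support_rows n a u @ row_prefix n a u n"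
  by (simp_all add: support_rows_def support_Suc row_prefix_def)

lemma row_prefix_0 [simp]: "row_prefix n a u 0 = []"
  and row_prefix_Suc: "row_prefix n a u (Suc v) = row_prefix n a u v @
    (if 0 < row_sum n a u \<and> 0 < row_sum n a v then [a u v] else [])"
  by (simp_all add: row_prefix_def support_Suc)

text \<open>Keeps the write address of the compaction from overtaking the read address.\<close>

lemma length_support_rows: "length (support_rows n a u) \<le> u * n"
proof (induction u)
  case (Suc u)
  then show ?case using length_row_prefix[of n a u n] by (simp add: support_rows_Suc)
qed simp

definition stores_matrix :: "nat \<Rightarrow> (nat \<Rightarrow> nat \<Rightarrow> nat) \<Rightarrow> (nat \<Rightarrow> nat) \<Rightarrow> bool" where
  "stores_matrix n a M \<longleftrightarrow> (\<forall>u<n. \<forall>v<n. M (2 + u * n + v) = a u v)"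

definition stores_degrees :: "nat \<Rightarrow> (nat \<Rightarrow> nat \<Rightarrow> nat) \<Rightarrow> nat \<Rightarrow> (nat \<Rightarrow> nat) \<Rightarrow> bool" where
  "stores_degrees n a u M \<longleftrightarrow> (\<forall>i<u. M (2 + n * n + i) = row_sum n a i)"

text \<open>Separates the matrix cells from the degree table that starts at
  \<open>2 + n * n\<close>.\<close>

lemma matrix_index_less:
  assumes "u < n" "v < n" shows "u * n + v < n * (n :: nat)"
proof -
  have "u * n + v < Suc u * n" using assms by simp
  also have "\<dots> \<le> n * n" using assms by (intro mult_right_mono) auto
  finally show ?thesis .
qed

section \<open>Correctness and running time of the scans and of the whole program\<close>

lemma runs_degree_scan:
  assumes ctrl: "R 0 = 0" "R 1 = 1" "R 2 = n" "R 4 = 2 + n * n" "R 10 = 0" "R 15 = 0" "R 3 = k"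
    "R 11 = 0"
    and M: "stores_matrix n a M" "M 1 = k"
  shows "runs degree_scan (R, M) (n * (n * 6 + 12) + 4) (\<lambda>(R, M). at_row n n R \<and>
    R 3 = k \<and> R 11 = 0 \<and> R 10 = (\<Sum>u<n. row_sum n a u) \<and> R 15 = length (support n a n) \<and>
    M 1 = k \<and> stores_matrix n a M \<and> stores_degrees n a n M)"
proof -
  define J where "J = (\<lambda>u (R :: nat \<Rightarrow> nat) M. R 3 = k \<and> R 11 = 0 \<and> R 10 = (\<Sum>i<u. row_sum n a i)
    \<and> R 15 = length (support n a u) \<and> M 1 = k \<and> stores_matrix n a M \<and> stores_degrees n a u M)"
  define I where "I = (\<lambda>u v R M. J u R M \<and> R (9 :: nat) = (\<Sum>j<v. a u j))"
  have "runs degree_scan (R, M)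
    (n * (n * (steps (Seq (Load 12 6) (Add 9 9 12)) + 4) + steps (Const 9 0)
      + steps (Seq (Store 16 9) (Seq (Add 10 10 9) (IfLess 0 9 (Add 15 15 1) skip))) + 6) + 4)
    (\<lambda>(R, M). at_row n n R \<and> J n R M)"
    unfolding degree_scan_def
  proof (rule runs_scan[where I = I])
    fix u R M assume u: "u < n" and en: "at_entry n u n R" and I: "I u n R M"
    \<comment> \<open>Storing the degree of \<open>u\<close> leaves the matrix intact.\<close>
    have "M (2 + i * n + j) = a i j" "2 + i * n + j \<noteq> 2 + n * n + u" if "i < n" "j < n" for i j
      using I that matrix_index_less[OF that] by (auto simp: I_def J_def stores_matrix_def)
    then show "case effect (Seq (Store 16 9) (Seq (Add 10 10 9) (IfLess 0 9 (Add 15 15 1) skip))) (R, M)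
      of (R', M') \<Rightarrow> at_entry n u n R' \<and> J (Suc u) R' M'"
      using en I
      by (auto simp: at_entry_def I_def J_def skip_def support_Suc row_sum_def[symmetric]
          stores_matrix_def stores_degrees_def less_Suc_eq)
  qed (use ctrl M in \<open>auto simp: skip_def at_row_def at_entry_def I_def J_def stores_matrix_def
        stores_degrees_def\<close>)
  then show ?thesis by (rule runs_mono) (auto simp: skip_def J_def algebra_simps)
qed

text \<open>Some vertex with \<open>k\<close> leaves is recorded, not the last one found, since all
  of them give a correct verdict.\<close>

definition pendant_verdict :: "nat \<Rightarrow> (nat \<Rightarrow> nat \<Rightarrow> nat) \<Rightarrow> nat \<Rightarrow> nat \<Rightarrow> nat \<Rightarrow> bool" where
  "pendant_verdict n a k u x \<longleftrightarrow> x = 0 \<and> (\<forall>i<u. leaf_count n a i < k) \<or>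
    (\<exists>i<u. k \<le> leaf_count n a i \<and>
      x = (if (\<Sum>i<n. row_sum n a i) < 2 * (row_sum n a i + k) then 1 else 2))"

lemma pendant_verdict_0: "pendant_verdict n a k 0 0"
  by (simp add: pendant_verdict_def)

lemma runs_pendant_scan:
  assumes ctrl: "R 0 = 0" "R 1 = 1" "R 2 = n" "R 4 = 2 + n * n" "R 3 = k" "R 11 = 0"
    and R: "R 10 = (\<Sum>u<n. row_sum n a u)" "R 15 = l"
    and M: "M 1 = k" "stores_matrix n a M" "stores_degrees n a n M"
  shows "runs pendant_scan (R, M) (n * (n * 9 + 13) + 4) (\<lambda>(R', M'). at_row n n R' \<and>
    R' 3 = k \<and> R' 10 = (\<Sum>u<n. row_sum n a u) \<and> R' 15 = l \<and> M' = M \<and>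
    pendant_verdict n a k n (R' 11))"
proof -
  define J where "J = (\<lambda>u (R :: nat \<Rightarrow> nat) M'. R 3 = k \<and> R 10 = (\<Sum>u<n. row_sum n a u) \<and>
    R 15 = l \<and> M' = M \<and> pendant_verdict n a k u (R 11))"
  define I where "I = (\<lambda>u v R M. J u R M \<and>
    R (9 :: nat) = length (filter (\<lambda>v. 0 < a u v \<and> row_sum n a v \<le> 1) [0..<v]))"
  let ?body = "Seq (Load 12 6) (Seq (Load 13 8) (IfLess 0 12 (IfLess 1 13 skip (Add 9 9 1)) skip))"
  let ?post = "IfLess 9 3 skip
      (Seq (Load 13 16) (Seq (Add 13 13 3) (Seq (Add 13 13 13)
        (IfLess 10 13 (Const 11 1) (Const 11 2)))))"
  have "runs pendant_scan (R, M)
    (n * (n * (steps ?body + 4) + steps (Const 9 0) + steps ?post + 6) + 4)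
    (\<lambda>(R, M). at_row n n R \<and> J n R M)"
    unfolding pendant_scan_def
  proof (rule runs_scan[where I = I])
    fix u v R M' assume u: "u < n" and v: "v < n" and en: "at_entry n u v R" and I: "I u v R M'"
    have "M (2 + u * n + v) = a u v" "M (2 + n * n + v) = row_sum n a v"
      using M u v by (auto simp: stores_matrix_def stores_degrees_def)
    then show "case effect ?body (R, M') of (R', M'') \<Rightarrow> at_entry n u v R' \<and> I u (Suc v) R' M''"
      using en I by (auto simp: at_entry_def I_def J_def skip_def)
  next
    fix u R M' assume u: "u < n" and en: "at_entry n u n R" and I: "I u n R M'"
    have m: "M (2 + n * n + u) = row_sum n a u"
      using M u by (auto simp: stores_degrees_def)
    have pv: "pendant_verdict n a k u (R 11)" using I by (simp add: I_def J_def)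
    have less: "pendant_verdict n a k (Suc u) (R 11)" if "leaf_count n a u < k"
      using pv that unfolding pendant_verdict_def by (metis less_Suc_eq)
    have ge: "pendant_verdict n a k (Suc u)
      (if (\<Sum>i<n. row_sum n a i) < 2 * (row_sum n a u + k) then 1 else 2)" if "k \<le> leaf_count n a u"
      using that unfolding pendant_verdict_def by blast
    have lc: "R 9 = leaf_count n a u" using I by (simp add: I_def leaf_count_def)
    show "case effect ?post (R, M') of (R', M'') \<Rightarrow> at_entry n u n R' \<and> J (Suc u) R' M''"
      using en I less ge m lc by (auto simp: at_entry_def I_def J_def skip_def not_less mult_2)
  qed (auto simp: skip_def at_row_def at_entry_def I_def J_def pendant_verdict_0 ctrl[simplified] R)
  then show ?thesis by (rule runs_mono) (auto simp: skip_def J_def algebra_simps)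
qed

text \<open>Overwriting the matrix is safe because the output is never longer than the part already
  read: the last clause of \<open>P\<close> keeps every cell from the read address on, including the
  degree table, unchanged.\<close>

lemma runs_compact_scan:
  assumes ctrl: "R 0 = 0" "R 1 = 1" "R 2 = n" "R 4 = 2 + n * n" "R 14 = 2" "R 15 = l"
    and M: "M 1 = k" "stores_matrix n a M" "stores_degrees n a n M"
  shows "runs compact_scan (R, M) (n * (n * 10 + 8) + 4) (\<lambda>(R, M).
    R 0 = 0 \<and> R 15 = l \<and> M 1 = k \<and>
    (\<forall>j<length (support_rows n a n). M (2 + j) = support_rows n a n ! j))"
proof -
  define P where "P = (\<lambda>u v xs (R :: nat \<Rightarrow> nat) M'. R 15 = l \<and> M' 1 = k \<and>
    R 14 = 2 + length xs \<and> (\<forall>j<length xs. M' (2 + j) = xs ! j) \<and>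
    (\<forall>j\<ge>2 + u * n + v. M' j = M j))"
  define J where "J = (\<lambda>u. P u 0 (support_rows n a u))"
  define I where "I = (\<lambda>u v R M. P u v (support_rows n a u @ row_prefix n a u v) R M \<and>
    R (9 :: nat) = row_sum n a u)"
  let ?body = "Seq (Load 12 6) (Seq (Load 13 8)
      (IfLess 0 9 (IfLess 0 13 (Seq (Store 14 12) (Add 14 14 1)) skip) skip))"
  have "runs compact_scan (R, M)
    (n * (n * (steps ?body + 4) + steps (Load 9 16) + steps skip + 6) + 4)
    (\<lambda>(R, M). at_row n n R \<and> J n R M)"
    unfolding compact_scan_def
  proof (rule runs_scan[where I = I])
    fix u R M' assume u: "u < n" and en: "at_row n u R" and J: "J u R M'"
    have "u * n \<le> n * n + u" using u by (intro trans_le_add1 mult_right_mono) auto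
    then have "M' (2 + n * n + u) = M (2 + n * n + u)" using J u by (simp add: J_def P_def)
    then have "M' (2 + n * n + u) = row_sum n a u" using M u by (simp add: stores_degrees_def)
    then show "case effect (Load 9 16) (R, M') of (R', M') \<Rightarrow> at_row n u R' \<and> I u 0 R' M'"
      using en J by (simp add: at_row_def I_def J_def P_def)
  next
    fix u v R M' assume u: "u < n" and v: "v < n" and en: "at_entry n u v R" and I: "I u v R M'"
    define xs where "xs = support_rows n a u @ row_prefix n a u v"
    have P: "P u v xs R M'" "R 9 = row_sum n a u" using I by (simp_all add: I_def xs_def)
    \<comment> \<open>An entry is written at \<open>2 + length xs\<close>, at or before the entry
      just read.\<close>
    have len: "length xs \<le> u * n + v"
      using length_support_rows[of n a u] length_row_prefix[of n a u v] by (simp add: xs_def)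
    have "M' (2 + u * n + v) = a u v"
      using P M u v by (simp add: P_def stores_matrix_def)
    moreover have "M' (2 + n * n + v) = row_sum n a v"
      using P M u v matrix_index_less[OF u v] by (simp add: P_def stores_degrees_def)
    moreover have "support_rows n a u @ row_prefix n a u (Suc v) =
        xs @ (if 0 < row_sum n a u \<and> 0 < row_sum n a v then [a u v] else [])"
      by (simp add: xs_def row_prefix_Suc)
    ultimately show "case effect ?body (R, M') of (R', M') \<Rightarrow> at_entry n u v R' \<and> I u (Suc v) R' M'"
      using en P len unfolding I_def
      by (auto simp: at_entry_def P_def skip_def nth_append less_Suc_eq)
  next
    fix u R M' assume u: "u < n" and en: "at_entry n u n R" and I: "I u n R M'"
    then show "case effect skip (R, M') of (R', M') \<Rightarrow> at_entry n u n R' \<and> J (Suc u) R' M'"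
      by (auto simp: skip_def at_entry_def I_def J_def P_def support_rows_Suc algebra_simps)
  qed (use ctrl M in \<open>auto simp: skip_def at_row_def at_entry_def I_def J_def P_def\<close>)
  then show ?thesis
    by (rule runs_mono) (auto simp: skip_def J_def P_def at_row_def algebra_simps)
qed

text \<open>For an adjacency matrix \<open>m2\<close> is twice the number of edges, hence the
  doubled thresholds. The constant 100 is generous.\<close>

lemma runs_kernel_prog:
  assumes M: "M 0 = n" "M 1 = k" "stores_matrix n a M"
  defines "m2 \<equiv> \<Sum>u<n. row_sum n a u"
  shows "runs kernel_prog (\<lambda>_. 0, M) (100 * (n * n + n + 1)) (\<lambda>s.
    (\<exists>u<n. k \<le> leaf_count n a u \<and>
      holds (if m2 < 2 * (row_sum n a u + k) then no_code else yes_code) s) \<or>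
    (\<forall>u<n. leaf_count n a u < k) \<and>
      holds (if m2 < 16 * k then length (support n a n) # k # support_rows n a n else yes_code) s)"
    (is "runs _ _ _ ?Q")
proof -
  let ?ctrl = "\<lambda>(R, M'). R 0 = 0 \<and> R 1 = 1 \<and> R 2 = n \<and> R 3 = k \<and> R 10 = 0 \<and> R 11 = 0 \<and>
    R (15 :: nat) = (0 :: nat) \<and> M' = M"
  let ?init = "Seq (Const 1 1) (Seq (Load 2 0) (Seq (Load 3 1) (Const 4 2)))"
  let ?I = "\<lambda>i (R, M'). ?ctrl (R, M') \<and> R 5 = i \<and> R 4 = 2 + i * n"
  have init: "runs ?init (\<lambda>_. 0, M) 4 (?I 0)"
    using runs_loop_free[of ?init "?I 0" "(\<lambda>_. 0, M)"] M by (simp add: eval_nat_numeral)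
  have base: "runs (WhileLess 5 2 (Seq (Add 4 4 2) (Add 5 5 1))) s (n * (2 + 1) + 1) (?I n)"
    if "?I 0 s" for s
  proof (rule runs_WhileLess[where I = ?I])
    fix i s assume i: "i < n" "?I i s"
    have "?I (Suc i) (effect (Seq (Add 4 4 2) (Add 5 5 1)) s)" using i by (cases s) auto
    then have "runs (Seq (Add 4 4 2) (Add 5 5 1)) s (steps (Seq (Add 4 4 2) (Add 5 5 1))) (?I (Suc i))"
      by (intro runs_loop_free) simp
    then show "fst s 5 < fst s 2 \<and> runs (Seq (Add 4 4 2) (Add 5 5 1)) s 2 (?I (Suc i))"
      using i by (auto simp: eval_nat_numeral)
  qed (use that in auto)
  let ?deg = "\<lambda>(R, M). at_row n n R \<and> R 3 = k \<and> R 11 = 0 \<and> R 10 = m2 \<and>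
    R 15 = length (support n a n) \<and> M 1 = k \<and> stores_matrix n a M \<and> stores_degrees n a n M"
  have deg: "runs degree_scan s (n * (n * 6 + 12) + 4) ?deg" if "?I n s" for s
  proof -
    obtain R M' where [simp]: "s = (R, M')" by (cases s)
    show ?thesis using that M unfolding m2_def
      by (simp only: \<open>s = (R, M')\<close>, intro runs_degree_scan[of R n k]) auto
  qed
  let ?pend = "\<lambda>(R, M). at_row n n R \<and> R 3 = k \<and> R 10 = m2 \<and>
    R 15 = length (support n a n) \<and> M 1 = k \<and> stores_matrix n a M \<and> stores_degrees n a n M \<and>
    pendant_verdict n a k n (R 11)"
  have pend: "runs pendant_scan s (n * (n * 9 + 13) + 4) ?pend" if "?deg s" for s
  proof -
    obtain R M where [simp]: "s = (R, M)" by (cases s)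
    show ?thesis using that unfolding m2_def
      by (simp only: \<open>s = (R, M)\<close>, intro runs_mono[OF runs_pendant_scan[of R n k]])
        (auto simp: at_row_def)
  qed
  let ?compact = "Seq (Const 14 2) (Seq compact_scan (Store 0 15))"
  have compact: "runs ?compact s (1 + (n * (n * 10 + 8) + 4 + 1))
      (holds (length (support n a n) # k # support_rows n a n))" if s: "?pend s" for s
  proof -
    obtain R M where [simp]: "s = (R, M)" by (cases s)
    have 1: "runs (Const 14 2) s 1 (\<lambda>s'. s' = (R(14 := 2), M))"
      using runs_loop_free[of "Const 14 2" "\<lambda>s'. s' = (R(14 := 2), M)" s] by simp
    let ?Q = "\<lambda>(R, M). R 0 = 0 \<and> R 15 = length (support n a n) \<and> M 1 = k \<and>
      (\<forall>j<length (support_rows n a n). M (2 + j) = support_rows n a n ! j)"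
    have 2: "runs compact_scan s' (n * (n * 10 + 8) + 4) ?Q" if "s' = (R(14 := 2), M)" for s'
      unfolding that using s by (intro runs_compact_scan) (auto simp: at_row_def)
    have 3: "runs (Store 0 15) s' 1 (holds (length (support n a n) # k # support_rows n a n))"
      if "?Q s'" for s'
    proof -
      have "holds (length (support n a n) # k # support_rows n a n) (effect (Store 0 15) s')"
        unfolding holds_def
      proof (intro allI impI)
        fix j assume "j < length (length (support n a n) # k # support_rows n a n)"
        \<comment> \<open>Cell 0 has just been written, cell 1 still holds \<open>k\<close>, and the
          later cells are the compacted rows.\<close>
        then show "snd (effect (Store 0 15) s') j = (length (support n a n) # k # support_rows n a n) ! j"
          using that by (cases s'; cases "(j, j - 1)" rule: prod.exhaust; cases j; cases "j - 1") auto
      qed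
      then show ?thesis using runs_loop_free[of "Store 0 15" _ s'] by simp
    qed
    show ?thesis by (rule runs_Seq[OF 1 runs_Seq[OF 2 3]])
  qed
  let ?double = "Seq (Add 13 3 3) (Seq (Add 13 13 13) (Seq (Add 13 13 13) (Add 13 13 13)))"
  let ?pend' = "\<lambda>s. ?pend s \<and> fst s 13 = 16 * k \<and> fst s 11 = 0"
  have double: "runs ?double s 4 ?pend'" if "?pend s" "fst s 11 = 0" for s
    proof -
    have "?pend' (effect ?double s)" using that by (cases s) (auto simp: at_row_def)
    then show ?thesis by (intro runs_mono[OF runs_loop_free]) simp_all
  qed
  \<comment> \<open>The 60 also covers writing \<open>yes_code\<close>, which takes
    \<open>3 * 18 + 1\<close> steps.\<close>
  let ?T = "60 + n * (n * 10 + 8)"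
  have small: "runs (IfLess 10 13 ?compact (store_list 0 yes_code)) s (Suc ?T) ?Q"
    if s: "?pend' s" for s
  proof (rule runs_IfLess)
    have all: "\<forall>u<n. leaf_count n a u < k" using s
      by (auto simp: pendant_verdict_def split: if_splits)
    {
      assume "fst s 10 < fst s 13"
      then have "m2 < 16 * k" using s by auto
      then show "runs ?compact s ?T ?Q"
        using s all by (intro runs_mono[OF compact]) auto
    next
      assume "\<not> fst s 10 < fst s 13"
      then have "\<not> m2 < 16 * k" using s by auto
      then show "runs (store_list 0 yes_code) s ?T ?Q"
        using all by (intro runs_mono[OF runs_store_list]) (auto simp: yes_code_def)
    }
  qed
  have verdict: "runs (IfLess 0 11 (IfLess 1 11 (store_list 0 yes_code) (store_list 0 no_code))
        (Seq ?double (IfLess 10 13 ?compact (store_list 0 yes_code)))) s (Suc (4 + Suc ?T)) ?Q"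
    if s: "?pend s" for s
  proof (rule runs_IfLess)
    have R: "fst s 0 = 0" "fst s 1 = 1" "pendant_verdict n a k n (fst s 11)"
      using s by (auto simp: at_row_def)
    {
      assume "fst s 0 < fst s 11"
      then obtain u where u: "u < n" "k \<le> leaf_count n a u"
        "fst s 11 = (if m2 < 2 * (row_sum n a u + k) then 1 else 2)"
        using R by (auto simp: pendant_verdict_def m2_def)
      have "runs (IfLess 1 11 (store_list 0 yes_code) (store_list 0 no_code)) s (Suc 60) ?Q"
      proof (rule runs_IfLess)
        assume "fst s 1 < fst s 11"
        then show "runs (store_list 0 yes_code) s 60 ?Q" using u R
          by (intro runs_mono[OF runs_store_list]) (auto simp: yes_code_def split: if_splits)
      next
        assume "\<not> fst s 1 < fst s 11"
        then show "runs (store_list 0 no_code) s 60 ?Q" using u R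
          by (intro runs_mono[OF runs_store_list]) (auto simp: no_code_def split: if_splits)
      qed
      then show "runs (IfLess 1 11 (store_list 0 yes_code) (store_list 0 no_code)) s (4 + Suc ?T) ?Q"
        by (rule runs_mono) auto
    next
      assume "\<not> fst s 0 < fst s 11"
      then have "fst s 11 = 0" using R by simp
      then show "runs (Seq ?double (IfLess 10 13 ?compact (store_list 0 yes_code))) s (4 + Suc ?T) ?Q"
        by (rule runs_Seq[OF double[OF s] small])
    }
  qed
  show ?thesis unfolding kernel_prog_def
    by (rule runs_mono[OF runs_Seq[OF init runs_Seq[OF base runs_Seq[OF deg runs_Seq[OF pend verdict]]]]])
      (auto simp: algebra_simps)
qed

section \<open>Correctness and size of the reduced instance\<close>

section \<open>The kernel\<close>

text \<open>The right side says that at least \<open>k\<close> edges avoid \<open>u\<close>. One of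
  two disjoint classes always avoids \<open>u\<close>; conversely \<open>u\<close> with its leaves
  serves one class and destroys no edge that avoids \<open>u\<close>.\<close>

lemma LCP_2_iff_if_many_pendants:
  assumes G: "simple_graph G" and u: "u \<in> verts G" and pend: "k \<le> card (pendants G u)"
  shows "G \<in> LCP 2 k \<longleftrightarrow> card (neighbors G u) + k \<le> card (edges G)"
proof
  assume "G \<in> LCP 2 k"
  then obtain A B where AB: "A \<inter> B = {}" "k \<le> card (edges_in G A)" "k \<le> card (edges_in G B)"
    unfolding LCP_2_iff[OF G] by blast
  then obtain C where C: "u \<notin> C" "k \<le> card (edges_in G C)" by blast
  have "edges_in G C \<subseteq> edges_in G (verts G - {u})"
    using C(1) simple_graphD(3)[OF G] by (fastforce simp: edges_in_def)
  then have "k \<le> card (edges_in G (verts G - {u}))"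
    using C(2) card_mono[OF finite_edges_in[OF G]] by (meson order_trans)
  then show "card (neighbors G u) + k \<le> card (edges G)" using card_edges_remove[OF G u] by simp
next
  assume le: "card (neighbors G u) + k \<le> card (edges G)"
  let ?P = "pendants G u" and ?B = "verts G - insert u (pendants G u)"
  \<comment> \<open>The only edge at a leaf leads to \<open>u\<close>.\<close>
  have "edges_in G (verts G - {u}) \<subseteq> edges_in G ?B"
  proof
    fix e assume e: "e \<in> edges_in G (verts G - {u})"
    have "p \<notin> ?P" if pe: "p \<in> e" for p
    proof
      assume p: "p \<in> ?P"
      obtain x y where "e = {x, y}" "x \<noteq> y"
        using e simple_graphD(4)[OF G, of e] unfolding edges_in_def card_2_iff by blast
      then obtain q where "e = {p, q}" using pe by (cases "p = x") auto
      then have "q \<in> neighbors G p" using e by (simp add: neighbors_iff G edges_in_def)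
      then show False using p e \<open>e = {p, q}\<close> by (auto simp: pendants_def edges_in_def)
    qed
    then show "e \<in> edges_in G ?B" using e by (auto simp: edges_in_def)
  qed
  then have "card (edges_in G (verts G - {u})) \<le> card (edges_in G ?B)"
    by (intro card_mono finite_edges_in G)
  then have "k \<le> card (edges_in G ?B)" using le card_edges_remove[OF G u] by simp
  moreover have "card ?P \<le> card (edges_in G (insert u ?P))"
    by (rule star_card_edges_in[OF G, of _ u]) (auto simp: pendants_def)
  ultimately show "G \<in> LCP 2 k" unfolding LCP_2_iff[OF G] using pend
    by (intro exI[of _ "insert u ?P"] exI[of _ ?B]) auto
qed

text \<open>Classes are transported by preimage and image under the renaming \<open>f\<close>. Only
  the edges have to correspond, so \<open>G\<close> may have additional isolated vertices.\<close>

lemma LCP_2_cong_image: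
  assumes G: "simple_graph G" and H: "simple_graph H"
    and inj: "inj_on f (verts H)" and E: "edges G = (`) f ` edges H"
  shows "card (edges G) = card (edges H)" and "G \<in> LCP 2 k \<longleftrightarrow> H \<in> LCP 2 k"
proof -
  have inj_E: "inj_on ((`) f) (edges H)"
  proof (rule inj_on_subset[OF inj_on_image_Pow[OF inj]])
    show "edges H \<subseteq> Pow (verts H)" using simple_graphD(3)[OF H] by blast
  qed
  then show "card (edges G) = card (edges H)" unfolding E by (rule card_image)
  have pull: "card (edges_in G A) = card (edges_in H (f -` A))" for A
  proof -
    have "edges_in G A = (`) f ` edges_in H (f -` A)"
      unfolding edges_in_def E image_subset_iff_subset_vimage[symmetric] by blast
    moreover have "inj_on ((`) f) (edges_in H (f -` A))"
      by (rule inj_on_subset[OF inj_E]) (simp add: edges_in_def)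
    ultimately show ?thesis by (simp add: card_image)
  qed
  have push: "card (edges_in H A) = card (edges_in G (f ` (A \<inter> verts H)))" for A
  proof -
    have "x \<in> f -` f ` (A \<inter> verts H) \<longleftrightarrow> x \<in> A" if "x \<in> verts H" for x
      using inj_on_image_mem_iff[OF inj that, of "A \<inter> verts H"] that by simp
    then have "e \<subseteq> f -` f ` (A \<inter> verts H) \<longleftrightarrow> e \<subseteq> A" if "e \<in> edges H" for e
      using simple_graphD(3)[OF H that] by (simp add: subset_iff)
    then have "edges_in H (f -` f ` (A \<inter> verts H)) = edges_in H A"
      unfolding edges_in_def by (intro Collect_cong conj_cong refl)
    then show ?thesis by (simp add: pull)
  qed
  show "G \<in> LCP 2 k \<longleftrightarrow> H \<in> LCP 2 k"
  proof
    assume "G \<in> LCP 2 k"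
    then obtain A B where "A \<inter> B = {}" "k \<le> card (edges_in G A)" "k \<le> card (edges_in G B)"
      unfolding LCP_2_iff[OF G] by blast
    then show "H \<in> LCP 2 k"
      unfolding LCP_2_iff[OF H] pull by (intro exI[of _ "f -` A"] exI[of _ "f -` B"]) auto
  next
    assume "H \<in> LCP 2 k"
    then obtain A B where AB: "A \<inter> B = {}" "k \<le> card (edges_in H A)" "k \<le> card (edges_in H B)"
      unfolding LCP_2_iff[OF H] by blast
    moreover have "f ` (A \<inter> verts H) \<inter> f ` (B \<inter> verts H) = {}"
      using inj_on_image_Int[OF inj, of "A \<inter> verts H" "B \<inter> verts H"] AB(1) by auto
    ultimately show "G \<in> LCP 2 k"
      unfolding LCP_2_iff[OF G] push by blast
  qed
qed

definition nonisolated :: "nat ugraph \<Rightarrow> nat list" where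
  "nonisolated G = filter (\<lambda>v. neighbors G v \<noteq> {}) [0..<card (verts G)]"

text \<open>The new name of a vertex is its position in \<open>S\<close>. The range condition on
  \<open>e\<close> excludes indices at which \<open>(!)\<close> is unspecified.\<close>

definition strip_isolated :: "nat ugraph \<Rightarrow> nat ugraph" where
  "strip_isolated G = (let S = nonisolated G in
    ({..<length S}, {e. e \<subseteq> {..<length S} \<and> (!) S ` e \<in> edges G}))"

definition yes_graph :: "nat ugraph" where
  "yes_graph = ({..<4}, {{0, 1}, {2, 3}})"

definition no_graph :: "nat ugraph" where
  "no_graph = ({}, {})"

text \<open>Membership in \<open>LCP 2 k\<close> is part of the specification; the program obtains
  it from counts, by \<open>LCP_2_iff_if_many_pendants\<close> or
  \<open>LCP_2_if_few_pendants\<close>.\<close>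

definition reduce_instance :: "nat ugraph \<times> nat \<Rightarrow> nat ugraph \<times> nat" where
  "reduce_instance = (\<lambda>(G, k).
    if (\<exists>u\<in>verts G. k \<le> card (pendants G u)) \<or> 8 * k \<le> card (edges G)
    then (if G \<in> LCP 2 k then yes_graph else no_graph, 1)
    else (strip_isolated G, k))"

lemma simple_yes_graph: "simple_graph yes_graph"
  by (simp add: yes_graph_def simple_graph_def)

lemma simple_no_graph: "simple_graph no_graph"
  by (simp add: no_graph_def simple_graph_def)

lemma yes_graph_LCP: "yes_graph \<in> LCP 2 1"
  by (rule LCP_2_if_matching[OF simple_yes_graph, of "edges yes_graph"])
    (simp_all add: yes_graph_def pairwise_insert disjnt_def doubleton_eq_iff)

lemma no_graph_LCP: "no_graph \<notin> LCP 2 1"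
  unfolding LCP_2_iff[OF simple_no_graph] by (simp add: edges_in_def no_graph_def)

lemma encode_yes: "encode (yes_graph, 1) = yes_code"
  by (simp add: encode_def yes_graph_def yes_code_def upt_rec doubleton_eq_iff)

lemma encode_no: "encode (no_graph, 1) = no_code"
  by (simp add: encode_def no_graph_def no_code_def)

text \<open>The edges correspond under \<open>(!) S\<close>. Every remaining vertex has degree at
  least 1, so the handshake lemma bounds their number.\<close>

lemma strip_isolated:
  assumes G: "simple_graph G" and V: "verts G = {..<card (verts G)}"
  shows simple_strip_isolated: "simple_graph (strip_isolated G)"
    and verts_strip_isolated: "verts (strip_isolated G) = {..<length (nonisolated G)}"
    and card_verts_strip_isolated: "card (verts (strip_isolated G)) \<le> 2 * card (edges G)"
    and card_edges_strip_isolated: "card (edges (strip_isolated G)) = card (edges G)"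
    and LCP_strip_isolated: "strip_isolated G \<in> LCP 2 k \<longleftrightarrow> G \<in> LCP 2 k"
proof -
  define S where "S = nonisolated G"
  have S: "distinct S" "set S = {v \<in> verts G. neighbors G v \<noteq> {}}"
    using V by (auto simp: S_def nonisolated_def)
  have C: "strip_isolated G = ({..<length S}, {e. e \<subseteq> {..<length S} \<and> (!) S ` e \<in> edges G})"
    by (simp add: strip_isolated_def S_def Let_def)
  then show "verts (strip_isolated G) = {..<length (nonisolated G)}" by (simp add: S_def)
  have inj: "inj_on ((!) S) (verts (strip_isolated G))"
    using S(1) by (simp add: C inj_on_nth)
  have "card e = 2" if "e \<subseteq> {..<length S}" "(!) S ` e \<in> edges G" for e
  proof -
    have "inj_on ((!) S) e" using inj_on_subset[OF inj, of e] that by (simp add: C)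
    then show ?thesis using simple_graphD(4)[OF G that(2)] by (simp add: card_image)
  qed
  then show simple: "simple_graph (strip_isolated G)" by (auto simp: simple_graph_def C)
  have "edges G \<subseteq> (`) ((!) S) ` edges (strip_isolated G)"
  proof
    fix e assume e: "e \<in> edges G"
    have "e \<subseteq> set S"
    proof
      fix x assume x: "x \<in> e"
      obtain a b where ab: "e = {a, b}"
        using simple_graphD(4)[OF G e] unfolding card_2_iff by blast
      then have "b \<in> neighbors G a" "a \<in> neighbors G b"
        using e by (simp_all add: neighbors_iff G insert_commute)
      then show "x \<in> set S" using x ab simple_graphD(3)[OF G e] S(2) by auto
    qed
    also have "set S = (!) S ` {..<length S}" by (auto simp: set_conv_nth)
    finally obtain e' where "e' \<subseteq> {..<length S}" "e = (!) S ` e'" by (auto simp: subset_image_iff)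
    then show "e \<in> (`) ((!) S) ` edges (strip_isolated G)" using e by (auto simp: C)
  qed
  then have E: "edges G = (`) ((!) S) ` edges (strip_isolated G)" by (auto simp: C)
  show "card (edges (strip_isolated G)) = card (edges G)"
    using LCP_2_cong_image(1)[OF G simple inj E] by simp
  show "strip_isolated G \<in> LCP 2 k \<longleftrightarrow> G \<in> LCP 2 k"
    using LCP_2_cong_image(2)[OF G simple inj E] by simp
  have "card (verts (strip_isolated G)) = card (set S)" using S(1) by (simp add: C distinct_card)
  also have "\<dots> = (\<Sum>v\<in>set S. 1)" by simp
  also have "\<dots> \<le> (\<Sum>v\<in>set S. card (neighbors G v))"
    using finite_neighbors[OF G] by (intro sum_mono) (auto simp: S(2) Suc_le_eq card_gt_0_iff)
  also have "\<dots> \<le> (\<Sum>v\<in>verts G. card (neighbors G v))"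
    using S(2) simple_graphD(1)[OF G] by (intro sum_mono2) auto
  also have "\<dots> = 2 * card (edges G)" by (rule handshake[OF G])
  finally show "card (verts (strip_isolated G)) \<le> 2 * card (edges G)" .
qed

section \<open>From graphs to the matrices handled by the program\<close>

definition adjacency :: "nat ugraph \<Rightarrow> nat \<Rightarrow> nat \<Rightarrow> nat" where
  "adjacency G u v = of_bool ({u, v} \<in> edges G)"

lemma row_sum_adjacency:
  assumes "simple_graph G" "verts G = {..<n}"
  shows "row_sum n (adjacency G) u = card (neighbors G u)"
proof -
  have "neighbors G u = {..<n} \<inter> {v. {u, v} \<in> edges G}"
    using assms by (auto simp: neighbors_def insert_commute)
  then show ?thesis by (simp add: row_sum_def adjacency_def)
qed

text \<open>A neighbor of \<open>u\<close> has degree at least 1, so degree at most 1 makes it a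
  leaf at \<open>u\<close>.\<close>

lemma leaf_count_adjacency:
  assumes G: "simple_graph G" and V: "verts G = {..<n}"
  shows "leaf_count n (adjacency G) u = card (pendants G u)"
proof -
  have leaf: "card (neighbors G v) \<le> 1 \<longleftrightarrow> neighbors G v = {u}" if "{u, v} \<in> edges G" for v
  proof -
    have "u \<in> neighbors G v" using that by (simp add: neighbors_iff G insert_commute)
    then show ?thesis using finite_neighbors[OF G, of v] by (auto simp: card_le_Suc0_iff_eq)
  qed
  have "leaf_count n (adjacency G) u =
      card (set (filter (\<lambda>v. 0 < adjacency G u v \<and> row_sum n (adjacency G) v \<le> 1) [0..<n]))"
    unfolding leaf_count_def by (subst distinct_card) auto
  also have "set (filter (\<lambda>v. 0 < adjacency G u v \<and> row_sum n (adjacency G) v \<le> 1) [0..<n])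
      = pendants G u"
    using leaf V by (auto simp: row_sum_adjacency[OF G V] pendants_def neighbors_iff G adjacency_def
        dest: simple_graphD(3)[OF G])
  finally show ?thesis .
qed

lemma support_adjacency:
  assumes "simple_graph G" "verts G = {..<n}"
  shows "support n (adjacency G) n = nonisolated G"
  using finite_neighbors[OF assms(1)]
  by (simp add: support_def nonisolated_def row_sum_adjacency[OF assms] card_gt_0_iff assms(2))

text \<open>Positions in \<open>S\<close> increase with the vertices, so the new matrix is the old
  one restricted to \<open>S\<close>, read in the order of the scan.\<close>

lemma encode_strip_isolated:
  assumes G: "simple_graph G" and V: "verts G = {..<n}"
  shows "encode (strip_isolated G, k) =
    length (support n (adjacency G) n) # k # support_rows n (adjacency G) n"
proof -
  define S where "S = nonisolated G"
  have "{i, j} \<in> edges (strip_isolated G) \<longleftrightarrow> {S ! i, S ! j} \<in> edges G"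
    if "i < length S" "j < length S" for i j
    using that by (simp add: strip_isolated_def S_def[symmetric])
  then have "map (\<lambda>j. of_bool ({i, j} \<in> edges (strip_isolated G))) [0..<length S]
      = map (adjacency G (S ! i)) S" if "i < length S" for i
    using that by (intro nth_equalityI) (auto simp: adjacency_def)
  then have "map (\<lambda>i. map (\<lambda>j. of_bool ({i, j} \<in> edges (strip_isolated G))) [0..<length S]) [0..<length S]
      = map (\<lambda>u. map (adjacency G u) S) S"
    by (intro nth_equalityI) auto
  moreover have "card (verts (strip_isolated G)) = length S"
    by (simp add: strip_isolated_def S_def Let_def)
  ultimately show ?thesis
    by (simp add: encode_def support_rows_def support_adjacency[OF G V] S_def[symmetric])
qed

lemma length_concat_const:
  "(\<And>xs. xs \<in> set xss \<Longrightarrow> length xs = n) \<Longrightarrow> length (concat xss) = length xss * n"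
  by (induction xss) auto

lemma nth_concat_const:
  "(\<And>xs. xs \<in> set xss \<Longrightarrow> length xs = n) \<Longrightarrow> i < length xss \<Longrightarrow> j < n \<Longrightarrow>
    concat xss ! (i * n + j) = xss ! i ! j"
proof (induction xss arbitrary: i)
  case (Cons xs xss)
  then show ?case by (cases i) (auto simp: nth_append)
qed simp

lemma encode:
  assumes "verts G = {..<n}"
  shows length_encode: "length (encode (G, k)) = n * n + 2"
    and encode_nth_0: "encode (G, k) ! 0 = n"
    and encode_nth_1: "encode (G, k) ! 1 = k"
    and encode_nth: "u < n \<Longrightarrow> v < n \<Longrightarrow> encode (G, k) ! (2 + u * n + v) = adjacency G u v"
proof -
  let ?rows = "map (\<lambda>u. map (adjacency G u) [0..<n]) [0..<n]"
  have e: "encode (G, k) = n # k # concat ?rows"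
    using assms by (simp add: encode_def adjacency_def[abs_def])
  show "length (encode (G, k)) = n * n + 2"
    unfolding e by (simp, subst length_concat_const[of _ n]) auto
  show "encode (G, k) ! 0 = n" "encode (G, k) ! 1 = k" by (simp_all add: e)
  show "encode (G, k) ! (2 + u * n + v) = adjacency G u v" if "u < n" "v < n"
    unfolding e using that by (simp, subst nth_concat_const[of _ n]) auto
qed

text \<open>Each entry, even 0, contributes its separator.\<close>

lemma length_le_bit_size: "length xs \<le> bit_size xs"
  unfolding bit_size_def by (induction xs) auto

lemma poly_time_reduce_instance: "poly_time_computable encode instances reduce_instance"
  unfolding poly_time_computable_def
proof (rule exI[of _ kernel_prog], rule exI[of _ "[:0, 0, 200:]"], rule ballI)
  fix x assume "x \<in> instances"
  then obtain G k where x: "x = (G, k)" and G: "simple_graph G"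
    and V: "verts G = {..<card (verts G)}" and k: "1 \<le> k"
    by (auto simp: instances_def)
  define n where "n = card (verts G)"
  have Vn: "verts G = {..<n}" using V by (simp add: n_def)
  let ?a = "adjacency G" and ?L = "bit_size (encode (G, k))"
  define M where "M = snd (initial_state (encode (G, k)))"
  have s: "initial_state (encode (G, k)) = (\<lambda>_. 0, M)" by (simp add: M_def initial_state_def)
  have M: "M 0 = n" "M 1 = k" "stores_matrix n ?a M"
    using encode[OF Vn] matrix_index_less[of _ n]
    by (auto simp: M_def initial_state_def stores_matrix_def)
  have m2: "(\<Sum>u<n. row_sum n ?a u) = 2 * card (edges G)"
    using handshake[OF G] by (simp add: row_sum_adjacency[OF G Vn] Vn)
  obtain t s' where ts: "exec kernel_prog (\<lambda>_. 0, M) t s'" "t \<le> 100 * (n * n + n + 1)"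
    and out: "(\<exists>u<n. k \<le> leaf_count n ?a u \<and>
      holds (if (\<Sum>u<n. row_sum n ?a u) < 2 * (row_sum n ?a u + k) then no_code else yes_code) s') \<or>
    (\<forall>u<n. leaf_count n ?a u < k) \<and>
      holds (if (\<Sum>u<n. row_sum n ?a u) < 16 * k
        then length (support n ?a n) # k # support_rows n ?a n else yes_code) s'"
    using runs_kernel_prog[OF M] unfolding runs_def by blast
  have "holds (encode (reduce_instance (G, k))) s'"
    using out
  proof (elim disjE exE conjE)
    fix u assume u: "u < n" "k \<le> leaf_count n ?a u"
      and h: "holds (if (\<Sum>u<n. row_sum n ?a u) < 2 * (row_sum n ?a u + k) then no_code else yes_code) s'"
    have u': "u \<in> verts G" "k \<le> card (pendants G u)"
      using u by (simp_all add: Vn leaf_count_adjacency[OF G Vn])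
    then have "reduce_instance (G, k) = (if G \<in> LCP 2 k then yes_graph else no_graph, 1)"
      by (auto simp: reduce_instance_def)
    then show ?thesis
      using h[unfolded m2] LCP_2_iff_if_many_pendants[OF G u']
      by (auto simp: row_sum_adjacency[OF G Vn] encode_yes[simplified] encode_no[simplified] split: if_splits)
  next
    assume all: "\<forall>u<n. leaf_count n ?a u < k"
      and h: "holds (if (\<Sum>u<n. row_sum n ?a u) < 16 * k
        then length (support n ?a n) # k # support_rows n ?a n else yes_code) s'"
    have all': "\<And>u. u \<in> verts G \<Longrightarrow> card (pendants G u) < k"
      using all by (simp add: Vn leaf_count_adjacency[OF G Vn])
    show ?thesis
    proof (cases "8 * k \<le> card (edges G)")
      case True
      then have "reduce_instance (G, k) = (yes_graph, 1)"
        using LCP_2_if_few_pendants[OF G True all'] by (simp add: reduce_instance_def)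
      then show ?thesis using h True by (simp add: m2 encode_yes[simplified])
    next
      case False
      then have "reduce_instance (G, k) = (strip_isolated G, k)"
        using all' by (force simp: reduce_instance_def)
      then show ?thesis using h False by (simp add: m2 encode_strip_isolated[OF G Vn])
    qed
  qed
  moreover have "t \<le> poly [:0, 0, 200:] ?L"
  proof -
    \<comment> \<open>The matrix gives the input at least \<open>n * n + 2\<close> bits, so even a
      linear bound holds; the quadratic polynomial dominates it.\<close>
    have L: "n * n + 2 \<le> ?L" using length_encode[OF Vn] length_le_bit_size by metis
    have "n \<le> n * n" by simp
    then have "n * n + n + 1 \<le> 2 * ?L" using L by linarith
    also have "\<dots> \<le> 2 * (?L * ?L)" by simp
    finally show ?thesis using ts(2) by simp
  qed
  ultimately show "\<exists>t s'. exec kernel_prog (initial_state (encode x)) t s' \<and>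
      t \<le> poly [:0, 0, 200:] (bit_size (encode x)) \<and>
      (\<forall>i<length (encode (reduce_instance x)). snd s' i = encode (reduce_instance x) ! i)"
    unfolding x s holds_def using ts(1) by blast
qed

theorem has_kernel: "has_load_coloring_kernel 2 (\<lambda>k. 8 * k)"
  unfolding has_load_coloring_kernel_def
proof (intro exI conjI)
  show "poly_time_computable encode instances reduce_instance" by (rule poly_time_reduce_instance)
  \<comment> \<open>This fixes \<open>g\<close> as \<open>24 * k\<close>: fewer than
    \<open>8 * k\<close> edges remain, and at most twice as many vertices. The fixed instances fit
    because \<open>k\<close> is at least 1.\<close>
  show "\<forall>(G, k)\<in>instances. \<exists>G' k'. reduce_instance (G, k) = (G', k') \<and> (G', k') \<in> instances \<and>
           (G \<in> LCP 2 k \<longleftrightarrow> G' \<in> LCP 2 k') \<and>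
           k' \<le> 24 * k \<and> card (verts G') + card (edges G') \<le> 24 * k \<and>
           card (edges G') < 8 * k"
  proof (intro ballI, clarify)
    fix G :: "nat ugraph" and k assume "(G, k) \<in> instances"
    then have G: "simple_graph G" and V: "verts G = {..<card (verts G)}" and k: "1 \<le> k"
      by (auto simp: instances_def)
    show "\<exists>G' k'. reduce_instance (G, k) = (G', k') \<and> (G', k') \<in> instances \<and>
           (G \<in> LCP 2 k \<longleftrightarrow> G' \<in> LCP 2 k') \<and>
           k' \<le> 24 * k \<and> card (verts G') + card (edges G') \<le> 24 * k \<and>
           card (edges G') < 8 * k"
    proof (cases "(\<exists>u\<in>verts G. k \<le> card (pendants G u)) \<or> 8 * k \<le> card (edges G)")
      case True
      have "card (edges yes_graph) \<le> 2" by (simp add: yes_graph_def card_insert_if)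
      then show ?thesis
        using True k simple_yes_graph simple_no_graph yes_graph_LCP no_graph_LCP
        by (auto simp: reduce_instance_def instances_def yes_graph_def no_graph_def)
    next
      case False
      then have "reduce_instance (G, k) = (strip_isolated G, k)" by (auto simp: reduce_instance_def)
      then show ?thesis
        using False k simple_strip_isolated[OF G V] verts_strip_isolated[OF G V] card_verts_strip_isolated[OF G V]
          card_edges_strip_isolated[OF G V] LCP_strip_isolated[OF G V, of k]
        by (simp add: instances_def)
    qed
  qed
qed

theorem theorem4:
  shows "(\<forall>(k :: nat) (G :: 'a ugraph).
            simple_graph G \<and> reduced 2 k G \<and> card (edges G) \<ge> 8 * k \<longrightarrow> G \<in> LCP 2 k)
       \<and> has_load_coloring_kernel 2 (\<lambda>k. 8 * k)"
proof (intro conjI allI impI has_kernel)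
  fix k and G :: "'a ugraph"
  assume "simple_graph G \<and> reduced 2 k G \<and> 8 * k \<le> card (edges G)"
  then show "G \<in> LCP 2 k"
    using LCP_2_if_few_pendants card_pendants_less_if_reduced by metis
qed

end
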